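(* Let $R$ be a commutative ring with unity of finite Krull dimension, and let $n$ be an integer with $n\geq \dim(R)+2$. Then the group $\mathrm{E}_{n}(R[X,X^{-1}])$ acts transitively on $\mathrm{Um}_{n}(R[X,X^{-1}])$.
   Context: All rings are commutative with unity (not assumed Noetherian), and $\dim$ denotes Krull dimension. For a ring $A$, $\mathrm{Um}_n(A)$ is the set of unimodular rows of length $n$, i.e. $(x_0,\dots,x_{n-1})\in A^n$ with $x_0A+\dots+x_{n-1}A=A$. $\mathrm{E}_n(A)$ is the subgroup of $\mathrm{GL}_n(A)$ generated by the elementary matrices $\mathrm{E}_{ij}(a)=I_n+a e_{ij}$ with $i\neq j$, $a\in A$, where $e_{ij}$ is the $n\times n$ matrix whose only nonzero entry is $1$ in position $(i,j)$. $\mathrm{E}_n(A)$ acts on $\mathrm{Um}_n(A)$ by right multiplication of rows by matrices. $R[X,X^{-1}]$ is the Laurent polynomial ring in one variable. *)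

theory Defs
  imports
    "HOL-Library.Poly_Mapping"
    "HOL-Library.Extended_Nat"
    "HOL-Algebra.Ideal"
    "HOL-Algebra.Generated_Groups"
    "HOL-Algebra.Algebraic_Closure_Type"
    "Jordan_Normal_Form.Gauss_Jordan_Elimination"
begin

text \<open>
  Krull dimension: the supremum of the lengths \<open>k\<close> of chains
  \<open>P 0 \<subset> P 1 \<subset> \<dots> \<subset> P k\<close> of prime ideals.  The value is meaningful for nonzero rings;
  for the zero ring the supremum is taken over the empty set and is \<open>0\<close>, but rings of class
  \<open>comm_ring_1\<close> are never zero.
\<close>

definition krull_dim :: "('a, 'b) ring_scheme \<Rightarrow> enat" where
  "krull_dim R = Sup {enat k | k. \<exists>P :: nat \<Rightarrow> 'a set.
     (\<forall>i\<le>k. primeideal (P i) R) \<and> (\<forall>i<k. P i \<subset> P (Suc i))}"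

text \<open>
  The Laurent polynomial ring \<open>R[X,X\<^sup>-\<^sup>1]\<close>: finitely supported families of coefficients indexed
  by the integer exponents, with the convolution product supplied by \<open>Poly_Mapping\<close>.
\<close>

type_synonym 'a laurent_poly = "int \<Rightarrow>\<^sub>0 'a"

definition unimodular_rows :: "nat \<Rightarrow> 'a :: comm_ring_1 vec set" where
  "unimodular_rows n = {x \<in> carrier_vec n. {x \<bullet> y | y. y \<in> carrier_vec n} = UNIV}"

definition general_linear :: "'a :: comm_ring_1 itself \<Rightarrow> nat \<Rightarrow> 'a mat monoid" where
  "general_linear T n = units_of (ring_mat T n ())"

text \<open>
  \<open>addrow_mat n a i j\<close> is the identity matrix with \<open>a\<close> added to its entry in position \<open>(i, j)\<close>.
\<close>

definition elementary_matrices :: "nat \<Rightarrow> 'a :: comm_ring_1 mat set" where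
  "elementary_matrices n = {addrow_mat n a i j | a i j. i < n \<and> j < n \<and> i \<noteq> j}"

text \<open>
  The library's \<open>subgroup_generated G S\<close> is generated by \<open>carrier G \<inter> S\<close>; the lemma below shows
  that here the intersection discards nothing.
\<close>

definition elementary_group :: "'a :: comm_ring_1 itself \<Rightarrow> nat \<Rightarrow> 'a mat monoid" where
  "elementary_group T n = subgroup_generated (general_linear T n) (elementary_matrices n)"

lemma elementary_matrices_subset_general_linear:
  "elementary_matrices n \<subseteq> carrier (general_linear TYPE('a :: comm_ring_1) n)"
proof
  fix M :: "'a mat"
  assume "M \<in> elementary_matrices n"
  then obtain a i j where M: "M = addrow_mat n a i j" and ij: "i < n" "j < n" "i \<noteq> j"
    by (auto simp: elementary_matrices_def)
  have inv: "addrow_mat n b i j * addrow_mat n (- b) i j = 1\<^sub>m n" for b :: 'a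
    using ij by (intro addrow_mat_inv) auto
  have "addrow_mat n (- a) i j * M = 1\<^sub>m n" "M * addrow_mat n (- a) i j = 1\<^sub>m n"
    using inv[of a] inv[of "- a"] by (simp_all add: M)
  then show "M \<in> carrier (general_linear TYPE('a) n)"
    unfolding general_linear_def units_of_carrier Units_def ring_mat_simps
    using addrow_mat_carrier[of n a i j] addrow_mat_carrier[of n "- a" i j] M by blast
qed

definition row_mult :: "'a :: comm_ring_1 vec \<Rightarrow> 'a mat \<Rightarrow> 'a vec" where
  "row_mult x M = row (mat_of_row x * M) 0"

text \<open>
  The library's locale \<open>transitive_action\<close> is about left actions (homomorphisms into the group of
  bijections), whereas matrices act on rows from the right.
\<close>

definition right_action :: "('g, 'c) monoid_scheme \<Rightarrow> 'x set \<Rightarrow> ('x \<Rightarrow> 'g \<Rightarrow> 'x) \<Rightarrow> bool" where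
  "right_action G S act \<longleftrightarrow> group G \<and>
     (\<forall>x\<in>S. \<forall>g\<in>carrier G. act x g \<in> S) \<and>
     (\<forall>x\<in>S. act x \<one>\<^bsub>G\<^esub> = x) \<and>
     (\<forall>x\<in>S. \<forall>g\<in>carrier G. \<forall>h\<in>carrier G. act x (g \<otimes>\<^bsub>G\<^esub> h) = act (act x g) h)"

definition transitive_right_action ::
    "('g, 'c) monoid_scheme \<Rightarrow> 'x set \<Rightarrow> ('x \<Rightarrow> 'g \<Rightarrow> 'x) \<Rightarrow> bool" where
  "transitive_right_action G S act \<longleftrightarrow> right_action G S act \<and>
     (\<forall>x\<in>S. \<forall>y\<in>S. \<exists>g\<in>carrier G. act x g = y)"

end

theory Submission
  imports Defs "Jordan_Normal_Form.Determinant"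
begin

text \<open>
  It suffices to carry every unimodular row of length \<open>k + 1\<close> over \<open>R[X,X\<^sup>-\<^sup>1]\<close>, where
  \<open>dim R < k\<close>, to \<open>(1, 0, \<dots>, 0)\<close> by elementary operations. Multiplying the row by a power of
  \<open>X\<close> makes its entries \<open>g, f\<^sub>1, \<dots>, f\<^sub>k\<close> polynomials; a common unit factor is harmless.

  The first idea is a stable range theorem for the localization of \<open>R[X]\<close> at the \<^emph>\<open>bimonic\<close>
  polynomials, those whose lowest and highest coefficients are both \<open>1\<close> (\<open>bimonic_stable_range\<close>):
  adding multiples of \<open>g\<close> to the \<open>f\<^sub>i\<close>, one can force the ideal \<open>(f\<^sub>1, \<dots>, f\<^sub>k)\<close> to contain a
  bimonic polynomial. For a ring that is not Noetherian, the dimension of \<open>R[X]\<close> can be as large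
  as \<open>2 dim R + 1\<close>, so the classical stable range theorem for \<open>R[X]\<close> would not give enough.
  Instead \<open>Spec\<close> is cut along the content \<open>C\<close> of a single entry \<open>f\<close>. On the boundary of \<open>V(C)\<close>
  the dimension of the coefficient ring drops and induction applies. Off \<open>V(C)\<close> only primes that
  contain \<open>f\<close> matter; there, primes over the same prime of \<open>R\<close> are incomparable, and a prime lying
  over a maximal ideal contains a bimonic polynomial (\<open>dim_below_generic_fibre\<close>). Hence this piece
  has dimension smaller than \<open>dim R\<close>, and one entry fewer suffices.

  Adding \<open>X\<^sup>-\<^sup>M s + X\<^sup>M s\<close> to \<open>g\<close>, for a bimonic \<open>s\<close> in that ideal and a large \<open>M\<close>, makes the first
  entry bimonic. Up to a power of \<open>X\<close> it is then a monic polynomial with constant coefficient \<open>1\<close>,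
  and the row is unimodular already over \<open>R[X]\<close>: its ideal contains a power of \<open>X\<close> as well as a
  polynomial congruent to \<open>1\<close> modulo \<open>X\<close>.

  The second idea is Suslin's reduction of the degree of the monic entry \<open>w\<close>
  (\<open>monic_row_equiv_e1\<close>). If the coefficients of the entries after the second one generate the unit
  ideal, then together with \<open>w\<close> these entries generate a polynomial of degree less than \<open>deg w\<close>
  with any prescribed coefficient in degree \<open>deg w - 1\<close>, so that the second entry can be made monic
  of degree \<open>deg w - 1\<close>. The hypothesis on the coefficients is achieved by the stable range
  theorem for \<open>R\<close> itself, applied to the many coefficients of remainders modulo \<open>w\<close>, with the norm
  of the second entry in \<open>R[X]/(w)\<close> as the element to be added (\<open>unimodular_content\<close>).

  A row of length two has no entries after the second one. It occurs only for \<open>dim R = 0\<close>, where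
  the Euclidean algorithm works modulo every prime and the different courses that it takes are
  glued along idempotents (\<open>zero_dim_euclid\<close>).

  No localization, quotient or residue field is constructed: a statement about
  \<open>Spec S\<^sup>-\<^sup>1A/K\<close> is phrased as one about the primes of \<open>A\<close> that contain \<open>K\<close> and miss \<open>S\<close>.
\<close>

hide_const (open) Polynomials.degree Polynomials.lead_coeff
  UnivPoly.coeff UnivPoly.monom UnivPoly.deg Module.smult

section \<open>Ideals, primes and dimension\<close>

text \<open>
  The ideal generated by \<open>S\<close>, as an inductive set, so that facts about its members can be proved
  by induction without handling linear combinations.
\<close>

inductive_set idl :: "'a :: comm_ring_1 set \<Rightarrow> 'a set" for S where
  zero: "0 \<in> idl S"
| base: "a \<in> S \<Longrightarrow> a \<in> idl S"
| add: "a \<in> idl S \<Longrightarrow> b \<in> idl S \<Longrightarrow> a + b \<in> idl S"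
| mult: "a \<in> idl S \<Longrightarrow> r * a \<in> idl S"

lemma idl_mult_right: "a \<in> idl S \<Longrightarrow> a * r \<in> idl S"
  using idl.mult[of a S r] by (simp add: mult.commute)

lemma idl_uminus: "a \<in> idl S \<Longrightarrow> - a \<in> idl S"
  using idl.mult[of a S "-1"] by simp

lemma idl_diff: "a \<in> idl S \<Longrightarrow> b \<in> idl S \<Longrightarrow> a - b \<in> idl S"
  using idl.add[of a S "- b"] idl_uminus[of b S] by simp

lemma idl_sum: "(\<And>i. i \<in> A \<Longrightarrow> f i \<in> idl S) \<Longrightarrow> sum f A \<in> idl S"
  by (induction A rule: infinite_finite_induct) (auto intro: idl.intros)

lemma idl_least: "S \<subseteq> idl T \<Longrightarrow> idl S \<subseteq> idl T"
proof
  fix x assume "S \<subseteq> idl T" "x \<in> idl S"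
  from this(2) \<open>S \<subseteq> idl T\<close> show "x \<in> idl T" by (induction) (auto intro: idl.intros)
qed

lemma idl_mono: "S \<subseteq> T \<Longrightarrow> idl S \<subseteq> idl T"
  by (rule idl_least) (auto intro: idl.base)

lemma idl_one: "1 \<in> idl S \<Longrightarrow> x \<in> idl S"
  using idl.mult[of 1 S x] by simp

lemma idl_empty: "x \<in> idl {} \<Longrightarrow> x = 0"
  by (induction rule: idl.induct) auto

lemma idl_UnE:
  assumes "x \<in> idl (A \<union> B)"
  obtains y z where "y \<in> idl A" "z \<in> idl B" "x = y + z"
proof -
  from assms have "\<exists>y\<in>idl A. \<exists>z\<in>idl B. x = y + z"
  proof induction
    case zero then show ?case by (auto intro!: bexI[of _ 0] intro: idl.zero)
  next
    case (base a)
    then show ?case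
    proof
      assume "a \<in> A" then show ?thesis by (intro bexI[of _ a] bexI[of _ 0]) (auto intro: idl.intros)
    next
      assume "a \<in> B" then show ?thesis by (intro bexI[of _ 0] bexI[of _ a]) (auto intro: idl.intros)
    qed
  next
    case (add a b)
    then obtain y z y' z' where "y \<in> idl A" "z \<in> idl B" "a = y + z" "y' \<in> idl A" "z' \<in> idl B" "b = y' + z'" by auto
    then show ?case by (intro bexI[of _ "y + y'"] bexI[of _ "z + z'"]) (auto intro: idl.intros)
  next
    case (mult a r)
    then obtain y z where "y \<in> idl A" "z \<in> idl B" "a = y + z" by auto
    then show ?case by (intro bexI[of _ "r * y"] bexI[of _ "r * z"]) (auto intro: idl.intros simp: algebra_simps)
  qed
  then show thesis using that by blast
qed

lemma idl_singletonE:
  assumes "x \<in> idl {a}"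
  obtains r where "x = r * a"
proof -
  from assms have "\<exists>r. x = r * a"
  proof induction
    case zero show ?case by (rule exI[of _ 0]) simp
  next
    case (base b) then show ?case by (intro exI[of _ 1]) simp
  next
    case (add b c) then show ?case by (metis distrib_right)
  next
    case (mult b r) then show ?case by (metis mult.assoc)
  qed
  then show thesis using that by blast
qed

lemma idl_insertE:
  assumes "x \<in> idl (insert a A)"
  obtains r y where "y \<in> idl A" "x = r * a + y"
proof -
  have "x \<in> idl ({a} \<union> A)" using assms by simp
  then obtain u y where "u \<in> idl {a}" "y \<in> idl A" "x = u + y" by (rule idl_UnE)
  then show thesis by (metis idl_singletonE that)
qed

lemma idl_unit_scale:
  assumes "u * v = 1" "1 \<in> idl S"
  shows "1 \<in> idl ((*) u ` S)"
proof -
  have "S \<subseteq> idl ((*) u ` S)"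
  proof
    fix x assume "x \<in> S"
    then have "v * (u * x) \<in> idl ((*) u ` S)" by (intro idl.mult idl.base) auto
    then show "x \<in> idl ((*) u ` S)" using assms(1) by (simp add: mult.assoc[symmetric] mult.commute[of v])
  qed
  then show ?thesis using idl_least assms(2) by blast
qed

definition prime_set :: "'a :: comm_ring_1 set \<Rightarrow> bool" where
  "prime_set P \<longleftrightarrow> idl P \<subseteq> P \<and> 1 \<notin> P \<and> (\<forall>a b. a * b \<in> P \<longrightarrow> a \<in> P \<or> b \<in> P)"

context
  fixes P :: "'a :: comm_ring_1 set"
  assumes P: "prime_set P"
begin

lemma prime_set_idl: "S \<subseteq> P \<Longrightarrow> idl S \<subseteq> P"
  using P idl_mono[of S P] by (auto simp: prime_set_def)

lemma prime_set_idlD: "x \<in> idl S \<Longrightarrow> S \<subseteq> P \<Longrightarrow> x \<in> P"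
  using prime_set_idl by blast

lemma prime_set_one: "1 \<notin> P"
  using P by (auto simp: prime_set_def)

lemma prime_set_zero: "0 \<in> P"
  using P idl.zero[of P] by (auto simp: prime_set_def)

lemma prime_set_add: "a \<in> P \<Longrightarrow> b \<in> P \<Longrightarrow> a + b \<in> P"
  using P idl.add[OF idl.base idl.base, of a P b] by (auto simp: prime_set_def)

lemma prime_set_mult: "a \<in> P \<Longrightarrow> r * a \<in> P"
  using P idl.mult[OF idl.base, of a P r] by (auto simp: prime_set_def)

lemma prime_set_mult_right: "a \<in> P \<Longrightarrow> a * r \<in> P"
  using prime_set_mult[of a r] by (simp add: mult.commute)

lemma prime_set_uminus: "a \<in> P \<Longrightarrow> - a \<in> P"
  using prime_set_mult[of a "-1"] by simp

lemma prime_set_diff: "a \<in> P \<Longrightarrow> b \<in> P \<Longrightarrow> a - b \<in> P"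
  using prime_set_add[of a "- b"] prime_set_uminus[of b] by simp

lemma prime_set_sum: "(\<And>i. i \<in> A \<Longrightarrow> f i \<in> P) \<Longrightarrow> sum f A \<in> P"
  by (induction A rule: infinite_finite_induct) (auto intro: prime_set_add prime_set_zero)

lemma prime_set_mult_iff: "a * b \<in> P \<longleftrightarrow> a \<in> P \<or> b \<in> P"
  using P prime_set_mult prime_set_mult_right by (auto simp: prime_set_def)

lemma prime_set_power: "a ^ n \<in> P \<Longrightarrow> a \<in> P"
  by (induction n) (auto simp: prime_set_one prime_set_mult_iff)

lemma prime_set_prod: "finite A \<Longrightarrow> prod f A \<in> P \<Longrightarrow> \<exists>i\<in>A. f i \<in> P"
  by (induction A rule: finite_induct) (auto simp: prime_set_one prime_set_mult_iff)

lemma prime_set_add_cancel: "a + b \<in> P \<Longrightarrow> b \<in> P \<Longrightarrow> a \<in> P"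
  using prime_set_diff[of "a + b" b] by simp

end

lemma prime_set_vimage:
  assumes Q: "prime_set Q" and h: "\<And>x y. h (x + y) = h x + h y" "\<And>x y. h (x * y) = h x * h y" "h 0 = 0" "h 1 = 1"
  shows "prime_set {x. h x \<in> Q}"
  unfolding prime_set_def
proof (intro conjI allI impI subsetI)
  fix x assume "x \<in> idl {x. h x \<in> Q}"
  then show "x \<in> {x. h x \<in> Q}"
    by induction (auto simp: h prime_set_zero[OF Q] prime_set_add[OF Q] prime_set_mult[OF Q])
qed (auto simp: h prime_set_one[OF Q] prime_set_mult_iff[OF Q])

definition mult_closed :: "'a :: comm_ring_1 set \<Rightarrow> bool" where
  "mult_closed S \<longleftrightarrow> 1 \<in> S \<and> (\<forall>a\<in>S. \<forall>b\<in>S. a * b \<in> S)"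

lemma prime_set_exists:
  fixes K T :: "'a :: comm_ring_1 set"
  assumes T: "mult_closed T" and disj: "idl K \<inter> T = {}"
  obtains P where "prime_set P" "K \<subseteq> P" "P \<inter> T = {}"
proof -
  define F where "F = {J. idl J \<subseteq> J \<and> K \<subseteq> J \<and> J \<inter> T = {}}"
  have "\<exists>M\<in>F. \<forall>U\<in>F. M \<subseteq> U \<longrightarrow> U = M"
  proof (rule subset_Zorn_nonempty)
    have "idl (idl K) \<subseteq> idl K" by (rule idl_least) simp
    then show "F \<noteq> {}" using disj idl.base[of _ K] unfolding F_def by (auto intro!: exI[of _ "idl K"])
  next
    fix C assume C: "C \<noteq> {}" "subset.chain F C"
    then have CF: "C \<subseteq> F" and lin: "\<And>U V. U \<in> C \<Longrightarrow> V \<in> C \<Longrightarrow> U \<subseteq> V \<or> V \<subseteq> U"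
      by (auto simp: subset.chain_def)
    have "x \<in> \<Union>C" if "x \<in> idl (\<Union>C)" for x
      using that
    proof induction
      case zero
      obtain J where "J \<in> C" using C by auto
      then show ?case using CF idl.zero[of J] unfolding F_def by blast
    next
      case (base a) then show ?case .
    next
      case (add a b)
      then obtain U V where XY: "U \<in> C" "V \<in> C" "a \<in> U" "b \<in> V" by auto
      then obtain Z where Z: "Z \<in> C" "a \<in> Z" "b \<in> Z" using lin[of U V] by blast
      then have "a + b \<in> idl Z" by (auto intro: idl.intros)
      then show ?case using Z CF unfolding F_def by blast
    next
      case (mult a r)
      then obtain U where "U \<in> C" "a \<in> U" by auto
      moreover then have "r * a \<in> idl U" by (auto intro: idl.intros)
      ultimately show ?case using CF unfolding F_def by blast
    qed
    then moreover obtain J where "J \<in> C" using C by auto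
    ultimately show "\<Union>C \<in> F" using CF unfolding F_def by blast
  qed
  then obtain M where M: "idl M \<subseteq> M" "K \<subseteq> M" "M \<inter> T = {}"
    and max: "\<And>U. U \<in> F \<Longrightarrow> M \<subseteq> U \<Longrightarrow> U = M" by (auto simp: F_def)
  have meet: "\<exists>t\<in>T. t \<in> idl (insert a M)" if "a \<notin> M" for a
  proof (rule ccontr)
    assume "\<not> ?thesis"
    then have "idl (insert a M) \<in> F"
      using idl_least[of "idl (insert a M)" "insert a M"] idl.base[of _ "insert a M"] M unfolding F_def by blast
    then have "idl (insert a M) = M" using idl.base[of _ "insert a M"] by (intro max) auto
    then show False using that idl.base[of a "insert a M"] by auto
  qed
  have "prime_set M" unfolding prime_set_def
  proof (intro conjI allI impI)
    show "idl M \<subseteq> M" by fact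
    show "1 \<notin> M" using M T by (auto simp: mult_closed_def)
    fix a b assume ab: "a * b \<in> M"
    show "a \<in> M \<or> b \<in> M"
    proof (rule ccontr)
      assume "\<not> ?thesis"
      then obtain s t where st: "s \<in> T" "t \<in> T" "s \<in> idl (insert a M)" "t \<in> idl (insert b M)"
        using meet by blast
      obtain r y where r: "y \<in> idl M" "s = r * a + y" using st by (auto elim: idl_insertE)
      obtain r' y' where r': "y' \<in> idl M" "t = r' * b + y'" using st by (auto elim: idl_insertE)
      have "s * t = (r * r') * (a * b) + (r' * b + y') * y + (r * a) * y'"
        using r r' by (simp add: algebra_simps)
      also have "\<dots> \<in> idl M"
        using idl.add[OF idl.add[OF idl.mult[OF idl.base[OF ab]] idl.mult[OF r(1)]] idl.mult[OF r'(1)]] .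
      finally have "s * t \<in> M" using M by auto
      moreover have "s * t \<in> T" using st T by (auto simp: mult_closed_def)
      ultimately show False using M by auto
    qed
  qed
  then show thesis using that M by blast
qed

lemma mult_closed_one: "mult_closed {1}"
  by (simp add: mult_closed_def)

lemma one_in_idlI:
  assumes "\<And>P. prime_set P \<Longrightarrow> K \<subseteq> P \<Longrightarrow> False"
  shows "1 \<in> idl K"
proof (rule ccontr)
  assume "1 \<notin> idl K"
  then obtain P where "prime_set P" "K \<subseteq> P" 
    using prime_set_exists[of "{1}" K] by (auto simp: mult_closed_def)
  then show False by (rule assms)
qed

lemma mult_closed_powers:
  assumes "mult_closed S"
  shows "mult_closed {s * a ^ n | s n. s \<in> S}"
  unfolding mult_closed_def
proof (intro conjI ballI)
  show "1 \<in> {s * a ^ n | s n. s \<in> S}"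
  proof -
    have "1 = 1 * a ^ 0 \<and> 1 \<in> S" using assms by (simp add: mult_closed_def)
    then show ?thesis by blast
  qed
  fix x y assume "x \<in> {s * a ^ n | s n. s \<in> S}" "y \<in> {s * a ^ n | s n. s \<in> S}"
  then obtain s n t m where "s \<in> S" "t \<in> S" "x = s * a ^ n" "y = t * a ^ m" by auto
  then have "x * y = (s * t) * a ^ (n + m)" "s * t \<in> S"
    using assms by (simp_all add: mult_closed_def power_add algebra_simps)
  then show "x * y \<in> {s * a ^ n | s n. s \<in> S}" by blast
qed

text \<open>
  A function on \<open>Spec S\<^sup>-\<^sup>1A/K\<close> that vanishes everywhere is nilpotent: otherwise \<open>K\<close> misses the
  products of elements of \<open>S\<close> with powers of \<open>a\<close>, and some prime over \<open>K\<close> does so too.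
\<close>

lemma radical_member:
  assumes S: "mult_closed S"
    and all: "\<And>P. prime_set P \<Longrightarrow> P \<inter> S = {} \<Longrightarrow> K \<subseteq> P \<Longrightarrow> a \<in> P"
  obtains s n where "s \<in> S" "s * a ^ n \<in> idl K"
proof (rule ccontr)
  assume "\<not> thesis"
  then have "s * a ^ n \<notin> idl K" if "s \<in> S" for s n using \<open>\<And>s n. s \<in> S \<Longrightarrow> s * a ^ n \<in> idl K \<Longrightarrow> thesis\<close> that by metis
  then have "idl K \<inter> {s * a ^ n | s n. s \<in> S} = {}" by auto
  then obtain P where P: "prime_set P" "K \<subseteq> P" "P \<inter> {s * a ^ n | s n. s \<in> S} = {}"
    using prime_set_exists[OF mult_closed_powers[OF S]] by blast
  have "s * a ^ n \<notin> P" if "s \<in> S" for s n using P(3) that by blast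
  note * = this[of _ 0] this[of 1 1]
  have "a \<in> P" using all[OF P(1) _ P(2)] *(1) by auto
  moreover have "1 * a ^ 1 \<notin> P" using *(2) S unfolding mult_closed_def by blast
  ultimately show False by simp
qed

text \<open>
  The assertion \<open>dim S\<^sup>-\<^sup>1A/K < k\<close>. Counting from \<open>0\<close> makes \<open>dim_below S K 0\<close> say that the
  localized quotient is the zero ring, which is a convenient start for inductions.
\<close>

definition dim_below :: "'a :: comm_ring_1 set \<Rightarrow> 'a set \<Rightarrow> nat \<Rightarrow> bool" where
  "dim_below S K k \<longleftrightarrow> \<not> (\<exists>P. (\<forall>i\<le>k. prime_set (P i) \<and> K \<subseteq> P i \<and> P i \<inter> S = {}) \<and>
      (\<forall>i<k. P i \<subset> P (Suc i)))"

lemma dim_below_no_chain: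
  assumes "dim_below S K k" "\<And>i. i \<le> k \<Longrightarrow> prime_set (P i) \<and> K \<subseteq> P i \<and> P i \<inter> S = {}"
    "\<And>i. i < k \<Longrightarrow> P i \<subset> P (Suc i)"
  shows False
  using assms(1) unfolding dim_below_def by (rule notE) (use assms(2,3) in \<open>intro exI[of _ P] conjI allI impI; simp\<close>)

lemma not_dim_belowE:
  assumes "\<not> dim_below S K k"
  obtains P where "\<And>i. i \<le> k \<Longrightarrow> prime_set (P i)" "\<And>i. i \<le> k \<Longrightarrow> K \<subseteq> P i" "\<And>i. i \<le> k \<Longrightarrow> P i \<inter> S = {}"
    "\<And>i. i < k \<Longrightarrow> P i \<subset> P (Suc i)"
  using assms unfolding dim_below_def by blast

lemma dim_below_mono: "dim_below S K k \<Longrightarrow> K \<subseteq> K' \<Longrightarrow> dim_below S K' k"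
  unfolding dim_below_def by blast

lemma dim_below_0: "dim_below S K 0 \<Longrightarrow> prime_set P \<Longrightarrow> K \<subseteq> P \<Longrightarrow> P \<inter> S = {} \<Longrightarrow> False"
  unfolding dim_below_def by auto

text \<open>
  The elements that restrict to zero on the open set where some element of \<open>C\<close> does not
  vanish: the
  saturation \<open>(K : C\<^sup>\<infinity>)\<close> in \<open>S\<^sup>-\<^sup>1A\<close>. Together with \<open>C\<close> it cuts out the topological boundary of
  \<open>V(C)\<close> in \<open>Spec S\<^sup>-\<^sup>1A/K\<close>.
\<close>

definition torsion :: "'a :: comm_ring_1 set \<Rightarrow> 'a set \<Rightarrow> 'a set \<Rightarrow> 'a set" where
  "torsion S K C = {y. \<forall>c\<in>C. \<exists>s\<in>S. \<exists>n. s * c ^ n * y \<in> idl K}"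

lemma idl_torsion:
  assumes "mult_closed S"
  shows "idl (torsion S K C) \<subseteq> torsion S K C"
proof
  fix x assume "x \<in> idl (torsion S K C)"
  then show "x \<in> torsion S K C"
  proof induction
    case zero
    then show ?case using assms by (auto simp: torsion_def mult_closed_def intro: idl.zero)
  next
    case (add a b)
    show ?case unfolding torsion_def
    proof (clarify)
      fix c assume "c \<in> C"
      then obtain s n t m where st: "s \<in> S" "t \<in> S" "s * c ^ n * a \<in> idl K" "t * c ^ m * b \<in> idl K"
        using add.IH unfolding torsion_def by blast
      have "(s * t) * c ^ (n + m) * (a + b) = (t * c ^ m) * (s * c ^ n * a) + (s * c ^ n) * (t * c ^ m * b)"
        by (simp add: power_add algebra_simps)
      also have "\<dots> \<in> idl K" using idl.add[OF idl.mult[OF st(3)] idl.mult[OF st(4)]] .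
      finally show "\<exists>s\<in>S. \<exists>n. s * c ^ n * (a + b) \<in> idl K"
        using st assms unfolding mult_closed_def by blast
    qed
  next
    case (mult a r)
    show ?case unfolding torsion_def
    proof (clarify)
      fix c assume "c \<in> C"
      then obtain s n where st: "s \<in> S" "s * c ^ n * a \<in> idl K"
        using mult.IH unfolding torsion_def by blast
      have "s * c ^ n * (r * a) = r * (s * c ^ n * a)" by (simp add: algebra_simps)
      also have "\<dots> \<in> idl K" using idl.mult[OF st(2)] .
      finally show "\<exists>s\<in>S. \<exists>n. s * c ^ n * (r * a) \<in> idl K" using st by blast
    qed
  qed
qed

lemma torsion_prime:
  assumes "prime_set P" "P \<inter> S = {}" "K \<subseteq> P" "y \<in> torsion S K C" "c \<in> C" "c \<notin> P"
  shows "y \<in> P"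
proof -
  obtain s n where sn: "s \<in> S" "s * c ^ n * y \<in> idl K" using assms by (auto simp: torsion_def)
  then have "s * c ^ n * y \<in> P" using assms prime_set_idlD by blast
  moreover have "s \<notin> P" using sn assms by auto
  ultimately show ?thesis using assms prime_set_mult_iff prime_set_power by metis
qed

text \<open>
  A prime \<open>P 0\<close> on the boundary of \<open>V(C)\<close> lies in the closure of the complement of \<open>V(C)\<close>, so a
  chain that starts there can be prolonged below by a prime \<open>Q\<close> that does not contain \<open>C\<close>. If for
  every \<open>c \<in> C\<close> such a \<open>Q\<close> avoiding \<open>c\<close> were obstructed by some \<open>q c \<notin> P 0\<close>, the product of the
  obstructions would belong to the torsion and hence to \<open>P 0\<close>. Finiteness of \<open>C\<close> enters here.
\<close>

lemma dim_below_boundary: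
  assumes S: "mult_closed S" and dim: "dim_below S K (Suc k)" and fin: "finite C"
  shows "dim_below S (K \<union> C \<union> torsion S K C) k"
proof (rule ccontr)
  assume "\<not> ?thesis"
  then obtain P where P: "\<And>i. i \<le> k \<Longrightarrow> prime_set (P i)" "\<And>i. i \<le> k \<Longrightarrow> K \<union> C \<union> torsion S K C \<subseteq> P i"
    "\<And>i. i \<le> k \<Longrightarrow> P i \<inter> S = {}" and chain: "\<And>i. i < k \<Longrightarrow> P i \<subset> P (Suc i)"
    unfolding dim_below_def by blast
  note P0 = P[of 0, simplified]
  have "\<exists>c\<in>C. \<forall>s\<in>S. \<forall>n q. q \<notin> P 0 \<longrightarrow> s * c ^ n * q \<notin> idl K"
  proof (rule ccontr)
    assume "\<not> ?thesis"
    then have "\<forall>c\<in>C. \<exists>q. q \<notin> P 0 \<and> (\<exists>s\<in>S. \<exists>n. s * c ^ n * q \<in> idl K)" by blast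
    then obtain q where q: "\<And>c. c \<in> C \<Longrightarrow> q c \<notin> P 0"
      "\<And>c. c \<in> C \<Longrightarrow> \<exists>s\<in>S. \<exists>n. s * c ^ n * q c \<in> idl K" by metis
    have "prod q C \<in> torsion S K C" unfolding torsion_def
    proof (clarify)
      fix c assume c: "c \<in> C"
      then obtain s n where sn: "s \<in> S" "s * c ^ n * q c \<in> idl K" using q by blast
      have "s * c ^ n * prod q C = prod q (C - {c}) * (s * c ^ n * q c)"
        using c fin by (simp add: prod.remove algebra_simps)
      then show "\<exists>s\<in>S. \<exists>n. s * c ^ n * prod q C \<in> idl K" using sn idl.mult by metis
    qed
    then have "prod q C \<in> P 0" using P0(2) by blast
    then show False using prime_set_prod[OF P0(1) fin] q by blast
  qed
  then obtain c where c: "c \<in> C" "\<And>s n q. s \<in> S \<Longrightarrow> q \<notin> P 0 \<Longrightarrow> s * c ^ n * q \<notin> idl K" by blast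
  \<comment> \<open>A prime that misses \<open>T\<close> misses \<open>S\<close>, does not contain \<open>c\<close>, and lies below \<open>P 0\<close>.\<close>
  define T where "T = {s * c ^ n * q | s n q. s \<in> S \<and> q \<notin> P 0}"
  have T_I: "s * c ^ n * q \<in> T" if "s \<in> S" "q \<notin> P 0" for s n q using that by (auto simp: T_def)
  have 1: "1 \<in> S" "1 \<notin> P 0" using S prime_set_one[OF P0(1)] by (auto simp: mult_closed_def)
  have "mult_closed T" unfolding mult_closed_def
  proof (intro conjI ballI)
    show "1 \<in> T" using T_I[of 1 1 0] 1 by simp
    fix x y assume "x \<in> T" "y \<in> T"
    then obtain s n q t m r where st: "s \<in> S" "t \<in> S" "q \<notin> P 0" "r \<notin> P 0" "x = s * c ^ n * q" "y = t * c ^ m * r"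
      by (auto simp: T_def)
    have "x * y = (s * t) * c ^ (n + m) * (q * r)" using st by (simp add: power_add algebra_simps)
    also have "\<dots> \<in> T" using st S by (intro T_I) (auto simp: mult_closed_def prime_set_mult_iff[OF P0(1)])
    finally show "x * y \<in> T" .
  qed
  moreover have "idl K \<inter> T = {}" using c by (auto simp: T_def)
  ultimately obtain Q where Q: "prime_set Q" "K \<subseteq> Q" "Q \<inter> T = {}" by (rule prime_set_exists)
  have QS: "Q \<inter> S = {}" using T_I[of _ 1 0] 1 Q by auto
  have QP: "Q \<subseteq> P 0" using T_I[of 1 _ 0] 1 Q by auto
  have cQ: "c \<notin> Q" using T_I[of 1 1 1] 1 Q by auto
  define P' where "P' = (\<lambda>i. case i of 0 \<Rightarrow> Q | Suc j \<Rightarrow> P j)"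
  have "prime_set (P' i) \<and> K \<subseteq> P' i \<and> P' i \<inter> S = {}" if "i \<le> Suc k" for i
    using that Q QS P by (cases i) (auto simp: P'_def)
  moreover have "P' i \<subset> P' (Suc i)" if "i < Suc k" for i
    using that QP cQ c P0 chain by (cases i) (auto simp: P'_def)
  ultimately show False using dim unfolding dim_below_def by blast
qed

text \<open>
  The stable range theorem for \<open>S\<^sup>-\<^sup>1A/K\<close>, in a form up to radicals. The induction peels off
  an entry \<open>b\<close> and treats the others on the boundary of \<open>V(b)\<close>, where the dimension has dropped.
  This yields \<open>s a\<^sup>n = w + y\<close> with \<open>w\<close> in the ideal of \<open>K\<close>, \<open>b\<close> and the modified entries, and \<open>y\<close>
  torsion with respect to \<open>b\<close>. The right multiplier for \<open>b\<close> is \<open>y\<close>: at a prime without \<open>b\<close> it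
  vanishes, so \<open>b + y a\<close> still does not vanish there; at a prime with \<open>b\<close> and \<open>y a\<close> either \<open>a\<close>
  vanishes or \<open>y\<close> does, and then so does \<open>s a\<^sup>n\<close>.
\<close>

lemma stable_range:
  fixes a :: "'a :: comm_ring_1"
  assumes S: "mult_closed S" and "dim_below S K k" and "k \<le> length bs"
  shows "\<exists>us. length us = length bs \<and>
    (\<forall>P. prime_set P \<longrightarrow> P \<inter> S = {} \<longrightarrow> K \<subseteq> P \<longrightarrow>
       set (map2 (\<lambda>b u. b + u * a) bs us) \<subseteq> P \<longrightarrow> a \<in> P)"
  using assms(2,3)
proof (induction k arbitrary: K bs)
  case 0
  then show ?case using dim_below_0 by (intro exI[of _ "replicate (length bs) 0"]) auto
next
  case (Suc k)
  then obtain b bs' where bs: "bs = b # bs'" by (cases bs) auto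
  define K' where "K' = K \<union> {b} \<union> torsion S K {b}"
  have "dim_below S K' k" unfolding K'_def by (rule dim_below_boundary[OF S Suc.prems(1)]) simp
  moreover have "k \<le> length bs'" using Suc bs by simp
  ultimately obtain us where us: "length us = length bs'" and
    usP: "\<And>P. prime_set P \<Longrightarrow> P \<inter> S = {} \<Longrightarrow> K' \<subseteq> P \<Longrightarrow>
       set (map2 (\<lambda>b u. b + u * a) bs' us) \<subseteq> P \<Longrightarrow> a \<in> P" using Suc.IH by meson
  let ?F = "set (map2 (\<lambda>b u. b + u * a) bs' us)"
  obtain s n where s: "s \<in> S" and sn: "s * a ^ n \<in> idl (K' \<union> ?F)"
    using radical_member[OF S, of "K' \<union> ?F" a] usP by (metis Un_subset_iff)
  have "K' \<union> ?F = (insert b (K \<union> ?F)) \<union> torsion S K {b}" by (auto simp: K'_def)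
  with sn have "s * a ^ n \<in> idl (insert b (K \<union> ?F) \<union> torsion S K {b})" by simp
  then obtain w y where w: "w \<in> idl (insert b (K \<union> ?F))" and y: "y \<in> torsion S K {b}"
    and eq: "s * a ^ n = w + y"
    by (rule idl_UnE) (use idl_torsion[OF S, of K "{b}"] in blast)
  have "a \<in> P" if P: "prime_set P" "P \<inter> S = {}" "K \<subseteq> P"
    and sub: "b + y * a \<in> P" "?F \<subseteq> P" for P
  proof (rule ccontr)
    assume a: "a \<notin> P"
    have "b \<in> P"
    proof (rule ccontr)
      assume b: "b \<notin> P"
      then have "y \<in> P" using torsion_prime[OF P(1,2,3) y] by auto
      then show False using b sub prime_set_add_cancel[OF P(1)] prime_set_mult_right[OF P(1)] by metis
    qed
    then have "y \<in> P" using sub a prime_set_add_cancel[OF P(1), of "y * a" b] prime_set_mult_iff[OF P(1)]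
      by (auto simp: add.commute)
    moreover have "w \<in> P" using w \<open>b \<in> P\<close> P sub prime_set_idlD[OF P(1) w] by auto
    ultimately have "s * a ^ n \<in> P" using eq prime_set_add[OF P(1)] by auto
    then show False using a P s prime_set_mult_iff[OF P(1)] prime_set_power[OF P(1)] by blast
  qed
  then show ?case using us bs by (intro exI[of _ "y # us"]) auto
qed

lemma stable_range_indexed:
  fixes a :: "'a :: comm_ring_1"
  assumes "mult_closed S" "dim_below S K k" "finite A" "k \<le> card A"
  obtains u where "\<And>P. prime_set P \<Longrightarrow> P \<inter> S = {} \<Longrightarrow> K \<subseteq> P \<Longrightarrow>
    (\<And>x. x \<in> A \<Longrightarrow> b x + u x * a \<in> P) \<Longrightarrow> a \<in> P"
proof -
  obtain xs where xs: "set xs = A" "distinct xs" using assms(3) finite_distinct_list by blast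
  have "k \<le> length (map b xs)" using assms(4) xs distinct_card by fastforce
  from stable_range[OF assms(1,2) this, of a] obtain us where
    us: "length us = length (map b xs)" and
    usP: "\<And>P. prime_set P \<Longrightarrow> P \<inter> S = {} \<Longrightarrow> K \<subseteq> P \<Longrightarrow>
       set (map2 (\<lambda>b u. b + u * a) (map b xs) us) \<subseteq> P \<Longrightarrow> a \<in> P" by meson
  define u where "u = (\<lambda>x. the (map_of (zip xs us) x))"
  have u: "u (xs ! i) = us ! i" if "i < length xs" for i
    using that xs us by (simp add: u_def map_of_zip_nth)
  have "map2 (\<lambda>b u. b + u * a) (map b xs) us = map (\<lambda>x. b x + u x * a) xs"
    using us u by (intro nth_equalityI) auto
  then have *: "set (map2 (\<lambda>b u. b + u * a) (map b xs) us) = (\<lambda>x. b x + u x * a) ` A"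
    using xs by simp
  show thesis
  proof (rule that[of u])
    fix P assume "prime_set P" "P \<inter> S = {}" "K \<subseteq> P" "\<And>x. x \<in> A \<Longrightarrow> b x + u x * a \<in> P"
    then show "a \<in> P" using usP[of P] unfolding * by blast
  qed
qed

text \<open>
  A stable range theorem for the open set of primes that do not contain all of \<open>gs\<close>, with
  multipliers in the ideal of \<open>gs\<close>, so that nothing changes on the complement. The open set is the
  disjoint union of the pieces where an element of \<open>gs\<close> is the first one that does not vanish. The
  pieces are treated starting with the last: the corrections made on the piece of \<open>g\<close> are multiples
  of \<open>g\<close> and vanish on all pieces treated before.
\<close>

lemma stable_range_off:
  fixes a :: "'a :: comm_ring_1"
  assumes S: "mult_closed S" and "\<And>g. g \<in> set gs \<Longrightarrow> dim_below {s * g ^ n | s n. s \<in> S} K k"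
    and len: "k \<le> length bs"
  shows "\<exists>vs. length vs = length bs \<and> set vs \<subseteq> idl (set gs) \<and>
    (\<forall>P. prime_set P \<longrightarrow> P \<inter> S = {} \<longrightarrow> K \<subseteq> P \<longrightarrow> \<not> set gs \<subseteq> P \<longrightarrow>
       set (map2 (\<lambda>b v. b + v * a) bs vs) \<subseteq> P \<longrightarrow> a \<in> P)"
  using assms(2)
proof (induction gs arbitrary: K)
  case Nil
  then show ?case by (intro exI[of _ "replicate (length bs) 0"]) (auto intro: idl.zero)
next
  case (Cons g gs)
  have "dim_below {s * h ^ n | s n. s \<in> S} (insert g K) k" if "h \<in> set gs" for h
    using Cons.prems[of h] that by (auto elim: dim_below_mono)
  from Cons.IH[OF this] obtain vs where vs: "length vs = length bs" "set vs \<subseteq> idl (set gs)" and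
    vsP: "\<And>P. prime_set P \<Longrightarrow> P \<inter> S = {} \<Longrightarrow> insert g K \<subseteq> P \<Longrightarrow> \<not> set gs \<subseteq> P \<Longrightarrow>
       set (map2 (\<lambda>b v. b + v * a) bs vs) \<subseteq> P \<Longrightarrow> a \<in> P" by meson
  define bs1 where "bs1 = map2 (\<lambda>b v. b + v * a) bs vs"
  have len1: "length bs1 = length bs" using vs by (simp add: bs1_def)
  let ?S = "{s * g ^ n | s n. s \<in> S}"
  obtain us where us: "length us = length bs1" and
    usP: "\<And>P. prime_set P \<Longrightarrow> P \<inter> ?S = {} \<Longrightarrow> K \<subseteq> P \<Longrightarrow>
       set (map2 (\<lambda>b u. b + u * (g * a)) bs1 us) \<subseteq> P \<Longrightarrow> g * a \<in> P"
    using stable_range[OF mult_closed_powers[OF S] Cons.prems[OF list.set_intros(1)], of bs1 "g * a"] len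
    unfolding len1 by meson
  define ws where "ws = map2 (\<lambda>v u. v + u * g) vs us"
  have lw: "length ws = length bs" using vs us len1 by (simp add: ws_def)
  have nth_eq: "map2 (\<lambda>b v. b + v * a) bs ws ! i = bs1 ! i + us ! i * (g * a)" if "i < length bs" for i
    using that vs us len1 by (simp add: ws_def bs1_def algebra_simps)
  have eq: "map2 (\<lambda>b v. b + v * a) bs ws = map2 (\<lambda>b u. b + u * (g * a)) bs1 us"
    using nth_eq lw us len1 by (intro nth_equalityI) auto
  have mem: "set ws \<subseteq> idl (set (g # gs))"
  proof
    fix w assume "w \<in> set ws"
    then obtain v u where vu: "v \<in> set vs" "w = v + u * g"
      by (auto simp: ws_def dest: set_zip_leftD)
    have "v \<in> idl (set (g # gs))" using vu vs idl_mono[of "set gs" "set (g # gs)"] by auto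
    then show "w \<in> idl (set (g # gs))" using vu by (auto intro!: idl.add idl.mult intro: idl.base)
  qed
  have fin: "a \<in> P" if P: "prime_set P" "P \<inter> S = {}" "K \<subseteq> P" "\<not> set (g # gs) \<subseteq> P"
    "set (map2 (\<lambda>b v. b + v * a) bs ws) \<subseteq> P" for P
  proof (cases "g \<in> P")
    case True
    have "set bs1 \<subseteq> P"
    proof
      fix x assume "x \<in> set bs1"
      then obtain i where i: "i < length bs" "x = bs1 ! i" by (auto simp: in_set_conv_nth len1)
      have "map2 (\<lambda>b v. b + v * a) bs ws ! i \<in> P"
        using P(5) i lw by (intro subsetD[OF P(5)] nth_mem) simp
      then have "x + us ! i * (g * a) \<in> P" using nth_eq i by simp
      moreover have "us ! i * (g * a) \<in> P"
        using prime_set_mult[OF P(1) prime_set_mult_right[OF P(1) True]] .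
      ultimately show "x \<in> P" by (rule prime_set_add_cancel[OF P(1)])
    qed
    then have "set (map2 (\<lambda>b v. b + v * a) bs vs) \<subseteq> P" by (simp only: bs1_def)
    moreover have "insert g K \<subseteq> P" "\<not> set gs \<subseteq> P" using P True by simp_all
    ultimately show ?thesis using vsP[OF P(1,2)] by blast
  next
    case False
    have "P \<inter> ?S = {}" using False P(1,2) prime_set_mult_iff[OF P(1)] prime_set_power[OF P(1)] by blast
    then have "g * a \<in> P" using usP[OF P(1)] P(3,5) unfolding eq by blast
    then show ?thesis using False prime_set_mult_iff[OF P(1)] by auto
  qed
  show ?case by (intro exI[of _ ws] conjI allI impI lw mem) (rule fin)
qed

section \<open>Elementary operations on rows\<close>

inductive row_equiv :: "'a :: comm_ring_1 list \<Rightarrow> 'a list \<Rightarrow> bool" (infix "\<sim>\<^sub>E" 50) where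
  refl: "xs \<sim>\<^sub>E xs"
| step: "xs \<sim>\<^sub>E ys \<Longrightarrow> i < length ys \<Longrightarrow> j < length ys \<Longrightarrow> i \<noteq> j \<Longrightarrow> xs \<sim>\<^sub>E ys[j := ys ! j + a * ys ! i]"

lemma row_equiv_length: "xs \<sim>\<^sub>E ys \<Longrightarrow> length ys = length xs"
  by (induction rule: row_equiv.induct) auto

lemma row_equiv_trans: "ys \<sim>\<^sub>E zs \<Longrightarrow> xs \<sim>\<^sub>E ys \<Longrightarrow> xs \<sim>\<^sub>E zs"
  by (induction rule: row_equiv.induct) (auto intro: row_equiv.step)

lemma row_equiv_trans' [trans]: "xs \<sim>\<^sub>E ys \<Longrightarrow> ys \<sim>\<^sub>E zs \<Longrightarrow> xs \<sim>\<^sub>E zs"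
  by (rule row_equiv_trans)

lemma row_equiv_step1: "i < length ys \<Longrightarrow> j < length ys \<Longrightarrow> i \<noteq> j \<Longrightarrow> ys \<sim>\<^sub>E ys[j := ys ! j + a * ys ! i]"
  by (rule row_equiv.step[OF row_equiv.refl])

lemma row_equiv_sym: "xs \<sim>\<^sub>E ys \<Longrightarrow> ys \<sim>\<^sub>E xs"
proof (induction rule: row_equiv.induct)
  case (refl xs) show ?case by (rule row_equiv.refl)
next
  case (step xs ys i j a)
  let ?zs = "ys[j := ys ! j + a * ys ! i]"
  have "?zs \<sim>\<^sub>E ?zs[j := ?zs ! j + (- a) * ?zs ! i]"
    using step by (intro row_equiv_step1) auto
  also have "?zs[j := ?zs ! j + (- a) * ?zs ! i] = ys" using step by simp
  also have "ys \<sim>\<^sub>E xs" by fact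
  finally show ?case .
qed

lemma row_equiv_idl_subset: "xs \<sim>\<^sub>E ys \<Longrightarrow> idl (set ys) \<subseteq> idl (set xs)"
proof (induction rule: row_equiv.induct)
  case (step xs ys i j a)
  have "idl (set (ys[j := ys ! j + a * ys ! i])) \<subseteq> idl (set ys)"
  proof (rule idl_least)
    have "ys ! j + a * ys ! i \<in> idl (set ys)"
      using step by (intro idl.add idl.mult idl.base nth_mem)
    then show "set (ys[j := ys ! j + a * ys ! i]) \<subseteq> idl (set ys)"
      using set_update_subset_insert[of ys j "ys ! j + a * ys ! i"] idl.base[of _ "set ys"] by blast
  qed
  then show ?case using step.IH by blast
qed auto

lemma row_equiv_idl: "xs \<sim>\<^sub>E ys \<Longrightarrow> idl (set ys) = idl (set xs)"
  using row_equiv_idl_subset row_equiv_sym by blast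

lemma row_equiv_map:
  assumes "\<And>x y. h (x + y) = h x + h y" "\<And>x y. h (x * y) = h x * h y"
  shows "xs \<sim>\<^sub>E ys \<Longrightarrow> map h xs \<sim>\<^sub>E map h ys"
proof (induction rule: row_equiv.induct)
  case (step xs ys i j a)
  have "map h (ys[j := ys ! j + a * ys ! i]) = (map h ys)[j := map h ys ! j + h a * map h ys ! i]"
    using step by (simp add: map_update assms)
  then show ?case using row_equiv.step[OF step.IH, of i j "h a"] step by simp
qed (rule row_equiv.refl)

lemma row_equiv_scale: "xs \<sim>\<^sub>E ys \<Longrightarrow> map ((*) u) xs \<sim>\<^sub>E map ((*) u) ys"
proof (induction rule: row_equiv.induct)
  case (step xs ys i j a)
  have "map ((*) u) (ys[j := ys ! j + a * ys ! i]) = (map ((*) u) ys)[j := map ((*) u) ys ! j + a * map ((*) u) ys ! i]"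
    using step by (simp add: map_update algebra_simps)
  then show ?case using row_equiv.step[OF step.IH, of i j a] step by simp
qed (rule row_equiv.refl)

text \<open>
  An idempotent splits the ring into two factors; operations can be carried out in the first factor
  only, by multiplying their coefficients by \<open>e\<close>.
\<close>

lemma row_equiv_idempotent_left:
  assumes "e * e = e" and "length us = length xs" and "xs \<sim>\<^sub>E ys"
  shows "map2 (\<lambda>x u. e * x + (1 - e) * u) xs us \<sim>\<^sub>E map2 (\<lambda>x u. e * x + (1 - e) * u) ys us"
  using assms(3,2)
proof (induction rule: row_equiv.induct)
  case (step xs ys i j a)
  let ?m = "\<lambda>ys. map2 (\<lambda>x u. e * x + (1 - e) * u) ys us"
  have len: "length us = length ys" using step row_equiv_length by metis
  have e: "e * (1 - e) = 0" using assms(1) by (simp add: algebra_simps)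
  have "e * (a * (ys ! i)) = (e * e) * (a * (ys ! i)) + (e * (1 - e)) * (a * us ! i)"
    unfolding e assms(1) by simp
  also have "\<dots> = (e * a) * (e * ys ! i + (1 - e) * us ! i)" by (simp add: algebra_simps)
  finally have eq: "e * (a * (ys ! i)) = (e * a) * (e * ys ! i + (1 - e) * us ! i)" .
  have "?m (ys[j := ys ! j + a * ys ! i]) ! k = ((?m ys)[j := ?m ys ! j + (e * a) * ?m ys ! i]) ! k"
    if "k < length ys" for k
    using that step(2-4) len eq
    by (cases "k = j") (simp_all add: distrib_left nth_list_update)
  then have "?m (ys[j := ys ! j + a * ys ! i]) = (?m ys)[j := ?m ys ! j + (e * a) * ?m ys ! i]"
    using len by (intro nth_equalityI) auto
  then show ?case using row_equiv.step[OF step.IH, of i j "e * a"] step len by simp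
qed (rule row_equiv.refl)

lemma row_equiv_glue:
  assumes e: "e * e = e" and "xs \<sim>\<^sub>E ys" "xs \<sim>\<^sub>E zs"
  shows "xs \<sim>\<^sub>E map2 (\<lambda>y z. e * y + (1 - e) * z) ys zs"
proof -
  have len: "length ys = length xs" "length zs = length xs" using assms row_equiv_length by auto
  have "xs = map2 (\<lambda>x u. e * x + (1 - e) * u) xs xs" by (rule nth_equalityI) (auto simp: algebra_simps)
  also have "\<dots> \<sim>\<^sub>E map2 (\<lambda>x u. e * x + (1 - e) * u) ys xs"
    by (rule row_equiv_idempotent_left[OF e HOL.refl assms(2)])
  also have "\<dots> = map2 (\<lambda>x u. (1 - e) * x + (1 - (1 - e)) * u) xs ys"
    using len by (intro nth_equalityI) (auto simp: algebra_simps)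
  also have "\<dots> \<sim>\<^sub>E map2 (\<lambda>x u. (1 - e) * x + (1 - (1 - e)) * u) zs ys"
    by (rule row_equiv_idempotent_left) (use e len assms(3) in \<open>auto simp: algebra_simps\<close>)
  also have "\<dots> = map2 (\<lambda>y z. e * y + (1 - e) * z) ys zs"
    using len by (intro nth_equalityI) (auto simp: algebra_simps)
  finally show ?thesis .
qed

lemma row_equiv_add_head:
  assumes "c \<in> idl (set ys)"
  shows "x # ys \<sim>\<^sub>E (x + c) # ys"
proof -
  have "x # ys \<sim>\<^sub>E (x + r * c) # ys" for r
    using assms
  proof (induction arbitrary: x r)
    case zero then show ?case by (simp add: row_equiv.refl)
  next
    case (base a)
    then obtain i where i: "i < length ys" "a = ys ! i" by (auto simp: in_set_conv_nth)
    then show ?case using row_equiv_step1[of "Suc i" "x # ys" 0 r] by auto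
  next
    case (add a b)
    have "x # ys \<sim>\<^sub>E (x + r * a) # ys" by fact
    also have "\<dots> \<sim>\<^sub>E (x + r * a + r * b) # ys" by fact
    finally show ?case by (simp add: algebra_simps)
  next
    case (mult a s)
    have "x # ys \<sim>\<^sub>E (x + (r * s) * a) # ys" by fact
    then show ?case by (simp add: algebra_simps)
  qed
  from this[of 1] show ?thesis by simp
qed

lemma row_equiv_add_tail:
  assumes "length ts = length ys"
  shows "x # ys \<sim>\<^sub>E x # map2 (\<lambda>y t. y + t * x) ys ts"
proof -
  have "x # us @ ys \<sim>\<^sub>E x # us @ map2 (\<lambda>y t. y + t * x) ys ts" for us
    using assms
  proof (induction ys arbitrary: us ts)
    case Nil then show ?case by (simp add: row_equiv.refl)
  next
    case (Cons y ys)
    then obtain t ts' where ts: "ts = t # ts'" "length ts' = length ys" by (cases ts) auto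
    have "x # us @ y # ys \<sim>\<^sub>E x # us @ (y + t * x) # ys"
      using row_equiv_step1[of 0 "x # us @ y # ys" "Suc (length us)" t] by simp
    also have "\<dots> = x # (us @ [y + t * x]) @ ys" by simp
    also have "\<dots> \<sim>\<^sub>E x # (us @ [y + t * x]) @ map2 (\<lambda>y t. y + t * x) ys ts'"
      by (rule Cons.IH[OF ts(2)])
    finally show ?case using ts by simp
  qed
  from this[of "[]"] show ?thesis by simp
qed

text \<open>
  Rows can be permuted only up to sign, since elementary matrices have determinant \<open>1\<close>.
\<close>

lemma row_equiv_swap: "x # y # zs \<sim>\<^sub>E y # (- x) # zs"
proof -
  have "x # y # zs \<sim>\<^sub>E (x + y) # y # zs" using row_equiv_step1[of 1 "x # y # zs" 0 1] by simp
  also have "\<dots> \<sim>\<^sub>E (x + y) # (- x) # zs" using row_equiv_step1[of 0 "(x + y) # y # zs" 1 "-1"] by simp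
  also have "\<dots> \<sim>\<^sub>E y # (- x) # zs" using row_equiv_step1[of 1 "(x + y) # (- x) # zs" 0 1] by simp
  finally show ?thesis .
qed

lemma row_equiv_add_tail_second:
  assumes "length ts = length zs"
  shows "x # y # zs \<sim>\<^sub>E x # y # map2 (\<lambda>z t. z + t * y) zs ts"
proof -
  have "x # y # zs \<sim>\<^sub>E y # (- x) # zs" by (rule row_equiv_swap)
  also have "\<dots> \<sim>\<^sub>E y # map2 (\<lambda>z t. z + t * y) (- x # zs) (0 # ts)"
    by (rule row_equiv_add_tail) (use assms in simp)
  also have "\<dots> = y # (- x) # map2 (\<lambda>z t. z + t * y) zs ts" by simp
  also have "\<dots> \<sim>\<^sub>E x # y # map2 (\<lambda>z t. z + t * y) zs ts" by (rule row_equiv_sym[OF row_equiv_swap])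
  finally show ?thesis .
qed

abbreviation e1 :: "nat \<Rightarrow> 'a :: comm_ring_1 list" where "e1 n \<equiv> 1 # replicate n 0"

lemma row_equiv_clear_tail: "set ys \<subseteq> idl {x} \<Longrightarrow> x # ys \<sim>\<^sub>E x # replicate (length ys) 0"
proof -
  assume "set ys \<subseteq> idl {x}"
  then have "\<forall>y\<in>set ys. \<exists>r. y = r * x" by (meson idl_singletonE subsetD)
  then obtain r where r: "\<And>y. y \<in> set ys \<Longrightarrow> y = r y * x" by metis
  have "x # ys \<sim>\<^sub>E x # map2 (\<lambda>y t. y + t * x) ys (map (\<lambda>y. - r y) ys)"
    by (rule row_equiv_add_tail) simp
  also have "map2 (\<lambda>y t. y + t * x) ys (map (\<lambda>y. - r y) ys) = replicate (length ys) 0"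
    using r by (intro nth_equalityI) (auto simp: nth_mem)
  finally show ?thesis .
qed

lemma row_equiv_e1_if_tail: "1 \<in> idl (set ys) \<Longrightarrow> x # ys \<sim>\<^sub>E e1 (length ys)"
proof -
  assume one: "1 \<in> idl (set ys)"
  have "x # ys \<sim>\<^sub>E (x + (1 - x)) # ys" by (rule row_equiv_add_head) (rule idl_one[OF one])
  also have "\<dots> = 1 # ys" by simp
  also have "\<dots> \<sim>\<^sub>E e1 (length ys)"
    using idl_one[OF idl.base[of 1 "{1}"]] by (intro row_equiv_clear_tail) auto
  finally show ?thesis .
qed

text \<open>
  The unit is moved away with the help of a second entry: \<open>(u, 0) \<leadsto> (u, 1) \<leadsto> (1, 1) \<leadsto> (1, 0)\<close>.
\<close>

lemma row_equiv_unit: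
  assumes "u * v = 1" "ys \<noteq> []"
  shows "u # ys \<sim>\<^sub>E e1 (length ys)"
proof -
  obtain y zs where ys: "ys = y # zs" using assms by (cases ys) auto
  have "x \<in> idl {u}" for x
    using idl_one[of "{u}"] idl.mult[OF idl.base[of u "{u}"], of v] assms by (simp add: mult.commute)
  then have "u # ys \<sim>\<^sub>E u # replicate (length ys) 0" by (intro row_equiv_clear_tail) auto
  also have "\<dots> = u # 0 # replicate (length zs) 0" using ys by simp
  also have "\<dots> \<sim>\<^sub>E u # 1 # replicate (length zs) 0"
    using row_equiv_step1[of 0 "u # 0 # replicate (length zs) 0" 1 v] assms by (simp add: mult.commute)
  also have "\<dots> \<sim>\<^sub>E e1 (length (1 # replicate (length zs) (0::'a)))"
    by (rule row_equiv_e1_if_tail) (auto intro: idl.base)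
  finally show ?thesis using ys by simp
qed

text \<open>
  Scaling a whole row by a unit commutes with elementary operations, and scales \<open>(1, 0, \<dots>, 0)\<close> to
  a row that is equivalent to it.
\<close>

lemma row_equiv_unit_scale:
  fixes u v :: "'a :: comm_ring_1"
  assumes uv: "u * v = 1" and n: "0 < n" and eq: "map ((*) u) xs \<sim>\<^sub>E e1 n"
  shows "xs \<sim>\<^sub>E e1 n"
proof -
  have "map ((*) v) (map ((*) u) xs) = xs"
    by (rule nth_equalityI) (use uv in \<open>auto simp: mult.assoc[symmetric] mult.commute[of v]\<close>)
  then have "xs \<sim>\<^sub>E map ((*) v) (e1 n)" using row_equiv_scale[OF eq, of v] by simp
  also have "map ((*) v) (e1 n) = v # replicate n 0" by simp
  also have "\<dots> \<sim>\<^sub>E e1 (length (replicate n (0 :: 'a)))"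
    by (rule row_equiv_unit[of _ u]) (use uv n in \<open>auto simp: mult.commute\<close>)
  finally show ?thesis by simp
qed

section \<open>Stable range relative to bimonic polynomials\<close>

abbreviation cst :: "'a :: comm_ring_1 \<Rightarrow> 'a poly" where "cst r \<equiv> [:r:]"

definition contraction :: "'a :: comm_ring_1 poly set \<Rightarrow> 'a set" where
  "contraction P = {r. cst r \<in> P}"

lemma cst_simps: "cst (a + b) = cst a + cst b" "cst (a * b) = cst a * cst b" "cst (a - b) = cst a - cst b"
  "cst (a ^ n) = cst a ^ n" "cst (- a) = - cst a"
  by (simp_all add: poly_const_pow)

lemma cst_idl: "a \<in> idl S \<Longrightarrow> cst a \<in> idl (cst ` S)"
proof (induction rule: idl.induct)
  case zero then show ?case by (simp add: idl.zero)
next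
  case (base a) then show ?case by (simp add: idl.base)
next
  case (add a b) then show ?case by (metis idl.add cst_simps(1))
next
  case (mult a r) then show ?case by (metis idl.mult cst_simps(2))
qed

lemma prime_set_contraction:
  assumes P: "prime_set P"
  shows "prime_set (contraction P)"
  unfolding contraction_def
  by (rule prime_set_vimage[where h = cst, OF P cst_simps(1,2)]) (simp_all flip: one_pCons)

lemma monom_eq_cst: "monom c i = cst c * monom 1 i"
  by (simp add: smult_monom)

lemma monom_in_prime: "prime_set P \<Longrightarrow> cst c \<in> P \<Longrightarrow> monom c i \<in> P"
  using prime_set_mult_right[of P "cst c" "monom 1 i"] unfolding monom_eq_cst[symmetric] .

lemma poly_in_prime:
  assumes "prime_set P" "\<And>i. coeff f i \<in> contraction P"
  shows "f \<in> P"
proof -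
  have "(\<Sum>i\<le>degree f. monom (coeff f i) i) \<in> P"
    using assms by (intro prime_set_sum monom_in_prime) (auto simp: contraction_def)
  then show ?thesis by (simp add: poly_as_sum_of_monoms)
qed

lemma poly_in_idl:
  assumes "\<And>i. coeff f i \<in> idl C"
  shows "f \<in> idl (cst ` C)"
proof -
  have "monom (coeff f i) i \<in> idl (cst ` C)" for i
    using idl_mult_right[OF cst_idl[OF assms[of i]], of "monom 1 i"] unfolding monom_eq_cst[symmetric] .
  then have "(\<Sum>i\<le>degree f. monom (coeff f i) i) \<in> idl (cst ` C)"
    by (intro idl_sum)
  then show ?thesis by (simp add: poly_as_sum_of_monoms)
qed

lemma degree_less_if_lead_cancels:
  assumes "degree p \<le> d" "coeff p d = 0" "0 < d"
  shows "degree p < d"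
  using assms by (metis degree_0 le_neq_implies_less leading_coeff_0_iff)

text \<open>
  Division by a polynomial that need not be monic, at the price of a power of its leading
  coefficient. The degree bound for \<open>q\<close> has to be recorded, because it cannot be recovered from the
  equation when the leading coefficient of \<open>w\<close> is a zero divisor.
\<close>

lemma pseudo_division:
  fixes w :: "'a :: comm_ring_1 poly"
  assumes "0 < degree w"
  shows "\<exists>k q r. smult (lead_coeff w ^ k) f = w * q + r \<and> degree r < degree w \<and> degree q \<le> degree f - degree w"
proof (induction "degree f" arbitrary: f rule: less_induct)
  case less
  let ?d = "degree f" and ?e = "degree w"
  show ?case
  proof (cases "?d < ?e")
    case True
    then show ?thesis by (intro exI[of _ 0] exI[of _ f]) auto
  next
    case False
    define m where "m = monom (lead_coeff f) (?d - ?e)"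
    define f1 where "f1 = smult (lead_coeff w) f - w * m"
    have dm: "degree m \<le> ?d - ?e" by (simp add: m_def degree_monom_le)
    have "degree (w * m) \<le> ?d" using degree_mult_le[of w m] dm False by linarith
    then have "degree f1 \<le> ?d" unfolding f1_def
      by (intro degree_diff_le) (auto intro: order_trans[OF degree_smult_le])
    moreover have "coeff (w * m) ?d = lead_coeff w * lead_coeff f"
      using False by (simp add: m_def coeff_monom_mult mult.commute[of w])
    then have "coeff f1 ?d = 0" by (simp add: f1_def)
    ultimately have d1: "degree f1 < ?d" using assms False by (intro degree_less_if_lead_cancels) auto
    from less[OF this] obtain k q r where
      IH: "smult (lead_coeff w ^ k) f1 = w * q + r" "degree r < ?e" "degree q \<le> degree f1 - ?e" by blast
    have "smult (lead_coeff w ^ Suc k) f = w * (q + smult (lead_coeff w ^ k) m) + r"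
      using IH(1) by (simp add: f1_def smult_diff_right algebra_simps)
    moreover have "degree (q + smult (lead_coeff w ^ k) m) \<le> ?d - ?e"
      using IH(3) d1 dm by (intro degree_add_le) (auto intro: order_trans[OF degree_smult_le])
    ultimately show ?thesis using IH(2) by blast
  qed
qed

text \<open>
  The generator of \<open>P \<kappa>[X]\<close>, where \<open>\<kappa>\<close> is the residue field of the contraction of \<open>P\<close>, with
  denominators cleared.
\<close>

lemma exists_minimal_coprime_lead:
  assumes P: "prime_set P" and f: "f \<in> P" "coeff f i \<notin> contraction P"
  obtains g where "g \<in> P" "lead_coeff g \<notin> contraction P"
    "\<And>h i. h \<in> P \<Longrightarrow> coeff h i \<notin> contraction P \<Longrightarrow> degree g \<le> degree h"
proof -
  let ?Q = "\<lambda>g. g \<in> P \<and> (\<exists>i. coeff g i \<notin> contraction P)"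
  define g where "g = arg_min degree ?Q"
  have g: "?Q g" and min: "\<And>h. ?Q h \<Longrightarrow> degree g \<le> degree h"
    using arg_min_nat_lemma[of ?Q f degree] f unfolding g_def by blast+
  have "lead_coeff g \<notin> contraction P"
  proof
    assume lc: "lead_coeff g \<in> contraction P"
    define g' where "g' = g - monom (lead_coeff g) (degree g)"
    have "g' \<in> P" unfolding g'_def using g lc
      by (intro prime_set_diff[OF P] monom_in_prime[OF P]) (auto simp: contraction_def)
    obtain i where i: "coeff g i \<notin> contraction P" using g by blast
    then have ne: "i \<noteq> degree g" using lc by auto
    then have "coeff g' i \<notin> contraction P" using i by (simp add: g'_def)
    then have le: "degree g \<le> degree g'" using min \<open>g' \<in> P\<close> by blast
    have "i < degree g" using ne i prime_set_zero[OF prime_set_contraction[OF P]] by (metis le_degree le_neq_implies_less)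
    moreover have "degree g' \<le> degree g" unfolding g'_def by (intro degree_diff_le) (auto simp: degree_monom_le)
    moreover have "coeff g' (degree g) = 0" by (simp add: g'_def)
    ultimately show False using degree_less_if_lead_cancels[of g' "degree g"] le by auto
  qed
  then show thesis using that g min by blast
qed

text \<open>
  Incomparability: primes over the same \<open>\<pp>\<close> that contain a polynomial outside \<open>\<pp>[X]\<close> correspond to
  nonzero primes of \<open>\<kappa>[X]\<close>, \<open>\<kappa>\<close> the residue field of \<open>\<pp>\<close>, and these are maximal. With denominators
  cleared, the proof runs as follows. Assume that the contractions agree and take \<open>h\<close> in \<open>P' - P\<close>. Among the
  elements outside \<open>P\<close> that are multiples of \<open>h\<close> modulo \<open>P\<close>, one of least degree, \<open>w\<close>, must be a constant,
  as dividing by \<open>w\<close> the element \<open>g\<close> of least degree in \<open>P - \<pp>[X]\<close> shows; but a constant in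
  \<open>P' - P\<close> distinguishes the two contractions.
\<close>

lemma contraction_strict:
  assumes P: "prime_set P" and P': "prime_set P'" and sub: "P \<subset> P'"
    and f: "f \<in> P" "coeff f i \<notin> contraction P'"
  shows "contraction P \<subset> contraction P'"
proof (rule ccontr)
  assume "\<not> ?thesis"
  then have eq: "contraction P' = contraction P" using sub by (auto simp: contraction_def)
  let ?p = "contraction P"
  have p: "prime_set ?p" by (rule prime_set_contraction[OF P])
  obtain h where h: "h \<in> P'" "h \<notin> P" using sub by blast
  obtain g where g: "g \<in> P" "lead_coeff g \<notin> ?p"
    and gmin: "\<And>u i. u \<in> P \<Longrightarrow> coeff u i \<notin> ?p \<Longrightarrow> degree g \<le> degree u"
    using exists_minimal_coprime_lead[OF P f(1)] f(2) eq by metis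
  let ?W = "\<lambda>w. w \<notin> P \<and> (\<exists>q. w - h * q \<in> P)"
  have "?W h" using h prime_set_zero[OF P] by (auto intro!: exI[of _ 1])
  \<comment> \<open>Outside \<open>P\<close>, and a multiple of \<open>h\<close> modulo \<open>P\<close>; hence in \<open>P'\<close>.\<close>
  define w where "w = arg_min degree ?W"
  have w: "?W w" and wmin: "\<And>v. ?W v \<Longrightarrow> degree w \<le> degree v"
    using arg_min_nat_lemma[of ?W h degree] \<open>?W h\<close> unfolding w_def by blast+
  obtain q0 where q0: "w - h * q0 \<in> P" using w by blast
  have wP': "w \<in> P'" using prime_set_add[OF P', of "w - h * q0" "h * q0"] q0 sub prime_set_mult_right[OF P' h(1)] by auto
  have Wclosed: "?W (c * w + u)" if "c \<notin> P" "u \<in> P" for c u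
  proof
    have "c * w \<notin> P" using that w prime_set_mult_iff[OF P] by auto
    then show "c * w + u \<notin> P" using prime_set_add_cancel[OF P] that by blast
    have "c * w + u - h * (c * q0) = c * (w - h * q0) + u" by (simp add: algebra_simps)
    also have "\<dots> \<in> P" using q0 that by (intro prime_set_add[OF P] prime_set_mult[OF P])
    finally show "\<exists>q. c * w + u - h * q \<in> P" by blast
  qed
  have lw: "lead_coeff w \<notin> ?p"
  proof
    assume lc: "lead_coeff w \<in> ?p"
    define w' where "w' = 1 * w + - monom (lead_coeff w) (degree w)"
    have m: "monom (lead_coeff w) (degree w) \<in> P" using lc by (intro monom_in_prime[OF P]) (auto simp: contraction_def)
    have "?W w'" unfolding w'_def
      by (rule Wclosed) (use prime_set_one[OF P] prime_set_uminus[OF P m] in auto)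
    then have le: "degree w \<le> degree w'" by (rule wmin)
    have "degree w > 0"
    proof (rule ccontr)
      assume "\<not> degree w > 0"
      then have "w = monom (lead_coeff w) (degree w)"
        by (intro poly_eqI) (auto simp: coeff_eq_0)
      then show False using m w by auto
    qed
    moreover have "degree w' \<le> degree w" unfolding w'_def by (intro degree_add_le) (auto simp: degree_monom_le)
    moreover have "coeff w' (degree w) = 0" by (simp add: w'_def)
    ultimately show False using degree_less_if_lead_cancels[of w' "degree w"] le by auto
  qed
  show False
  proof (cases "degree w = 0")
    case True
    then have "w = cst (lead_coeff w)" by (metis degree_0_id)
    then have "lead_coeff w \<in> contraction P'" using wP' by (simp add: contraction_def)
    then show False using lw eq by auto
  next
    case False
    show False
    proof (cases "degree g < degree w")
      case True
      \<comment> \<open>One reduction step of \<open>w\<close> by \<open>g\<close> contradicts the minimality of \<open>w\<close>.\<close>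
      define m where "m = monom (lead_coeff w) (degree w - degree g)"
      define w' where "w' = cst (lead_coeff g) * w + - (m * g)"
      have "cst (lead_coeff g) \<notin> P" using g by (simp add: contraction_def)
      then have "?W w'" unfolding w'_def
        by (rule Wclosed) (intro prime_set_uminus[OF P] prime_set_mult[OF P] g(1))
      then have le: "degree w \<le> degree w'" by (rule wmin)
      have "degree m \<le> degree w - degree g" by (simp add: m_def degree_monom_le)
      then have "degree (m * g) \<le> degree w" using degree_mult_le[of m g] True by linarith
      then have "degree w' \<le> degree w" unfolding w'_def
        by (intro degree_add_le) (auto intro: order_trans[OF degree_smult_le])
      moreover have "coeff (m * g) (degree w) = lead_coeff w * lead_coeff g"
        using True by (simp add: m_def coeff_monom_mult)
      then have "coeff w' (degree w) = 0" by (simp add: w'_def)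
      ultimately show False using degree_less_if_lead_cancels[of w' "degree w"] le False by auto
    next
      case ge: False
      \<comment> \<open>The remainder is in \<open>P\<close> by minimality of \<open>w\<close>, hence so is \<open>q\<close>; then \<open>q\<close> vanishes modulo the
        contraction by minimality of \<open>g\<close>, although \<open>w q\<close> has the leading term of a multiple of \<open>g\<close>.\<close>
      obtain k q r where div: "smult (lead_coeff w ^ k) g = w * q + r" "degree r < degree w"
        "degree q \<le> degree g - degree w" using pseudo_division[of w g] False by auto
      have "r = (- q) * w + smult (lead_coeff w ^ k) g" using div(1) by simp
      moreover have gk: "smult (lead_coeff w ^ k) g \<in> P"
        using prime_set_mult[OF P g(1), of "cst (lead_coeff w ^ k)"] by simp
      ultimately have rW: "- q \<notin> P \<Longrightarrow> ?W r" using Wclosed[of "- q" "smult (lead_coeff w ^ k) g"] by simp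
      have "q \<in> P"
      proof (rule ccontr)
        assume "q \<notin> P"
        then have "- q \<notin> P" using prime_set_uminus[OF P, of "- q"] by auto
        then show False using wmin[OF rW] div(2) by auto
      qed
      then have "coeff q i \<in> ?p" for i using gmin[of q i] div(3) False ge by fastforce
      then have "coeff (w * q) (degree g) \<in> ?p"
        unfolding coeff_mult by (intro prime_set_sum[OF p] prime_set_mult[OF p])
      moreover have "coeff (w * q) (degree g) = lead_coeff w ^ k * lead_coeff g"
        using arg_cong[OF div(1), of "\<lambda>u. coeff u (degree g)"] div(2) ge
        by (simp add: coeff_eq_0)
      ultimately show False using g(2) lw prime_set_mult_iff[OF p] prime_set_power[OF p] by auto
    qed
  qed
qed

definition bimonic :: "'a :: comm_ring_1 poly set" where
  "bimonic = {p. lead_coeff p = 1 \<and> (\<exists>i. coeff p i = 1 \<and> (\<forall>j<i. coeff p j = 0))}"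

lemma monic_mult:
  fixes p q :: "'a :: comm_ring_1 poly"
  assumes "lead_coeff p = 1" "lead_coeff q = 1"
  shows "lead_coeff (p * q) = 1" "degree (p * q) = degree p + degree q"
proof -
  have 1: "coeff (p * q) (degree p + degree q) = 1" using assms by (simp add: coeff_mult_degree_sum)
  then show 2: "degree (p * q) = degree p + degree q"
    using degree_mult_le[of p q] le_degree[of "p * q" "degree p + degree q"] by simp
  show "lead_coeff (p * q) = 1" using 1 2 by simp
qed

lemma mult_closed_bimonic: "mult_closed (bimonic :: 'a :: comm_ring_1 poly set)"
  unfolding mult_closed_def
proof (intro conjI ballI)
  show "1 \<in> (bimonic :: 'a poly set)" by (auto simp: bimonic_def intro!: exI[of _ 0])
  fix p q :: "'a poly" assume pq: "p \<in> bimonic" "q \<in> bimonic"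
  then obtain i i' where i: "coeff p i = 1" "\<forall>j<i. coeff p j = 0" "coeff q i' = 1" "\<forall>j<i'. coeff q j = 0"
    by (auto simp: bimonic_def)
  have c: "coeff (p * q) n = (if n = i + i' then 1 else 0)" if "n \<le> i + i'" for n
  proof -
    have "coeff p k * coeff q (n - k) = (if k = i then if n = i + i' then 1 else 0 else 0)" if "k \<le> n" for k
    proof (cases "k < i \<or> n - k < i'")
      case True
      then show ?thesis using i \<open>n \<le> i + i'\<close> \<open>k \<le> n\<close> by auto
    next
      case False
      then have "k = i" "n = i + i'" using \<open>n \<le> i + i'\<close> \<open>k \<le> n\<close> by auto
      then show ?thesis using i by auto
    qed
    then have "coeff (p * q) n = (\<Sum>k\<le>n. if k = i then if n = i + i' then 1 else 0 else 0)"
      unfolding coeff_mult by (intro sum.cong) auto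
    also have "\<dots> = (if n = i + i' then 1 else 0)" by auto
    finally show ?thesis .
  qed
  have "lead_coeff (p * q) = 1" using pq by (intro monic_mult) (auto simp: bimonic_def)
  then show "p * q \<in> bimonic" using c[of "i + i'"] c unfolding bimonic_def by (auto intro!: exI[of _ "i + i'"])
qed

lemma maximal_prime_inverse:
  fixes I :: "'a :: comm_ring_1 set"
  assumes dim: "dim_below {1} I (Suc k)"
    and P: "\<And>i. i \<le> k \<Longrightarrow> prime_set (P i)" "\<And>i. i \<le> k \<Longrightarrow> I \<subseteq> P i" "\<And>i. i < k \<Longrightarrow> P i \<subset> P (Suc i)"
    and a: "a \<notin> P k"
  shows "\<exists>x. x * a - 1 \<in> P k"
proof -
  have "1 \<in> idl (insert a (P k))"
  proof (rule one_in_idlI)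
    fix Q assume Q: "prime_set Q" "insert a (P k) \<subseteq> Q"
    define P' where "P' = P(Suc k := Q)"
    have "I \<subseteq> Q" using P(2)[of k] Q(2) by blast
    have "prime_set (P' i) \<and> I \<subseteq> P' i \<and> P' i \<inter> {1} = {}" if "i \<le> Suc k" for i
      using that P Q \<open>I \<subseteq> Q\<close> prime_set_one[OF Q(1)] prime_set_one[OF P(1)]
      by (auto simp: P'_def le_Suc_eq)
    moreover have "P' i \<subset> P' (Suc i)" if "i < Suc k" for i
      using that P(3) Q a by (auto simp: P'_def less_Suc_eq)
    ultimately show False by (rule dim_below_no_chain[OF dim])
  qed
  then obtain r y where "y \<in> idl (P k)" "1 = r * a + y" by (rule idl_insertE)
  then have "r * a - 1 = - y" "y \<in> P k" using prime_set_idlD[OF P(1)[of k]] by (auto simp: algebra_simps)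
  then show ?thesis using prime_set_uminus[OF P(1)[of k]] by (intro exI[of _ r]) auto
qed

text \<open>
  Over a residue field every nonzero polynomial has invertible lowest and highest coefficients
  \<open>\<alpha>\<close> and \<open>\<omega>\<close>. Then \<open>\<alpha>\<^sup>-\<^sup>1 f + \<omega>\<^sup>-\<^sup>1 X f\<close> has lowest and highest coefficient \<open>1\<close>; the shift by
  \<open>X\<close> keeps the two corrections apart. Coefficients that lie in the contraction are then replaced
  by the exact values \<open>0\<close> and \<open>1\<close>.
\<close>

lemma bimonic_meets:
  assumes P: "prime_set P" and inv: "\<And>a. a \<notin> contraction P \<Longrightarrow> \<exists>x. x * a - 1 \<in> contraction P"
    and f: "f \<in> P" "coeff f i \<notin> contraction P"
  shows "P \<inter> bimonic \<noteq> {}"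
proof -
  let ?p = "contraction P"
  have p: "prime_set ?p" by (rule prime_set_contraction[OF P])
  define N where "N = {i. coeff f i \<notin> ?p}"
  have "N \<subseteq> {..degree f}" using prime_set_zero[OF p] by (auto simp: N_def) (metis coeff_eq_0 not_le)
  then have fin: "finite N" by (rule finite_subset) simp
  have ne: "N \<noteq> {}" using f by (auto simp: N_def)
  define l u where "l = Min N" and "u = Max N"
  have l: "coeff f l \<notin> ?p" and u: "coeff f u \<notin> ?p" using Min_in[OF fin ne] Max_in[OF fin ne] by (auto simp: N_def l_def u_def)
  have lu: "l \<le> u" using Min_le[OF fin Max_in[OF fin ne]] by (simp add: l_def u_def)
  have low: "coeff f j \<in> ?p" if "j < l" for j using Min_le[OF fin, of j] that by (force simp: N_def l_def)
  have high: "coeff f j \<in> ?p" if "u < j" for j using Max_ge[OF fin, of j] that by (force simp: N_def u_def)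
  obtain x y where x: "x * coeff f l - 1 \<in> ?p" and y: "y * coeff f u - 1 \<in> ?p" using inv l u by blast
  define g where "g = cst x * f + cst y * pCons 0 f"
  have "pCons 0 f = monom 1 1 * f" by (simp add: monom_Suc)
  then have "pCons 0 f \<in> P" using prime_set_mult[OF P f(1)] by metis
  then have gP: "g \<in> P" unfolding g_def using f by (intro prime_set_add[OF P] prime_set_mult[OF P])
  have cg: "coeff g j = x * coeff f j + y * (if j = 0 then 0 else coeff f (j - 1))" for j
    by (cases j) (simp_all add: g_def)
  define c where "c = (\<lambda>j. if j = l \<or> j = Suc u then 1 else if j < l \<or> Suc u < j then 0 else coeff g j)"
  define g' where "g' = (\<Sum>j\<le>Suc u. monom (c j) j)"
  have cg': "coeff g' j = c j" for j
  proof -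
    have "coeff g' j = (\<Sum>k\<le>Suc u. if k = j then c k else 0)" unfolding g'_def coeff_sum by (intro sum.cong) auto
    then show ?thesis using lu by (auto simp: c_def)
  qed
  have diff: "coeff (g - g') j \<in> ?p" for j
  proof -
    have ppos: "j = 0 \<or> coeff f (j - 1) \<in> ?p" if "j \<le> l" using that low[of "j - 1"] by (cases j) auto
    consider "j = l" | "j = Suc u" | "j < l \<or> Suc u < j" | "l < j" "j \<le> u" by linarith
    then show ?thesis
    proof cases
      case 1
      have "coeff (g - g') j = (x * coeff f l - 1) + y * (if j = 0 then 0 else coeff f (j - 1))"
        using 1 by (simp add: cg cg' c_def)
      then show ?thesis using x ppos 1 prime_set_zero[OF p] prime_set_add[OF p] prime_set_mult[OF p] by auto
    next
      case 2
      have "coeff (g - g') j = (y * coeff f u - 1) + x * coeff f (Suc u)"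
        using 2 by (simp add: cg cg' c_def)
      then show ?thesis using y high[of "Suc u"] prime_set_add[OF p] prime_set_mult[OF p] by auto
    next
      case 3
      then have "coeff (g - g') j = x * coeff f j + y * (if j = 0 then 0 else coeff f (j - 1))"
        using lu by (auto simp add: cg cg' c_def)
      moreover have "coeff f j \<in> ?p" using 3 low high[of j] by auto
      moreover have "j \<le> l \<or> u < j - 1" using 3 by linarith
      then have "j = 0 \<or> coeff f (j - 1) \<in> ?p" using ppos high by blast
      ultimately show ?thesis using prime_set_zero[OF p] prime_set_add[OF p] prime_set_mult[OF p] by auto
    next
      case 4
      then show ?thesis using prime_set_zero[OF p] by (simp add: cg' c_def)
    qed
  qed
  have "g - g' \<in> P" by (rule poly_in_prime[OF P diff])
  then have "g' \<in> P" using prime_set_diff[OF P gP] by fastforce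
  moreover have "degree g' = Suc u"
  proof (rule antisym)
    show "degree g' \<le> Suc u" by (rule degree_le) (use lu in \<open>auto simp: cg' c_def\<close>)
    show "Suc u \<le> degree g'" by (rule le_degree) (simp add: cg' c_def)
  qed
  then have "g' \<in> bimonic" unfolding bimonic_def using lu by (auto simp: cg' c_def intro!: exI[of _ l])
  ultimately show ?thesis by blast
qed

text \<open>
  A chain of primes of the kind considered contracts to a strict chain of the same length by
  incomparability. If it had \<open>k + 1\<close> members, the last contraction would be a maximal ideal, for it
  could not be extended by a larger prime, and the last prime would contain a bimonic polynomial.
  This is where inverting bimonic polynomials saves one dimension.
\<close>

lemma dim_below_generic_fibre:
  fixes I :: "'a :: comm_ring_1 set"
  assumes dim: "dim_below {1} I (Suc k)" and c: "c \<in> set (coeffs f)"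
  shows "dim_below {s * cst c ^ n | s n. s \<in> bimonic} (insert f (cst ` I)) k"
proof (rule ccontr)
  assume "\<not> ?thesis"
  then obtain P where P: "\<And>i. i \<le> k \<Longrightarrow> prime_set (P i)" "\<And>i. i \<le> k \<Longrightarrow> insert f (cst ` I) \<subseteq> P i"
    "\<And>i. i \<le> k \<Longrightarrow> P i \<inter> {s * cst c ^ n | s n. s \<in> bimonic} = {}" and chain: "\<And>i. i < k \<Longrightarrow> P i \<subset> P (Suc i)"
    by (rule not_dim_belowE) blast
  obtain j where j: "c = coeff f j" using c by (auto simp: coeffs_def split: if_splits)
  have S: "s * cst c ^ n \<notin> P i" if "i \<le> k" "s \<in> bimonic" for i s n using P(3)[OF that(1)] that(2) by blast
  have one: "1 \<in> (bimonic :: 'a poly set)" using mult_closed_bimonic by (auto simp: mult_closed_def)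
  have cP: "coeff f j \<notin> contraction (P i)" if "i \<le> k" for i
    using S[OF that one, of 1] by (simp add: contraction_def j)
  define Q where "Q = (\<lambda>i. contraction (P i))"
  have Q: "prime_set (Q i)" "I \<subseteq> Q i" if "i \<le> k" for i
    using prime_set_contraction[OF P(1)] P(2) that by (auto simp: Q_def contraction_def)
  have Qchain: "Q i \<subset> Q (Suc i)" if "i < k" for i
    unfolding Q_def using that P chain cP[of "Suc i"] by (intro contraction_strict[of _ _ f]) auto
  have inv: "\<exists>x. x * a - 1 \<in> contraction (P k)" if "a \<notin> contraction (P k)" for a
    using maximal_prime_inverse[OF dim, of Q a] Q Qchain that by (simp add: Q_def)
  have "P k \<inter> bimonic \<noteq> {}"
    using P(2)[of k] cP[of k] by (intro bimonic_meets[OF P(1)[OF order.refl] inv, of f j]) auto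
  then show False using S[of k _ 0] by auto
qed

text \<open>
  The multiplier \<open>y\<close> of the entry \<open>f\<close> is found as in \<open>stable_range\<close>, on the boundary of \<open>V(C)\<close>,
  where \<open>C\<close> is the set of coefficients of \<open>f\<close>. At primes that contain \<open>C\<close> this settles the matter.
  At the other primes \<open>y\<close> vanishes, so that \<open>f\<close> may be assumed to vanish as well, and the
  remaining entries are corrected once more, by multiples of \<open>C\<close>, with \<open>stable_range_off\<close>.
\<close>

theorem bimonic_stable_range:
  fixes I :: "'a :: comm_ring_1 set" and g :: "'a poly"
  assumes "dim_below {1} I k" and "k \<le> length fs"
  shows "\<exists>ts. length ts = length fs \<and>
    (\<forall>P. prime_set P \<longrightarrow> P \<inter> bimonic = {} \<longrightarrow> cst ` I \<subseteq> P \<longrightarrow>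
       set (map2 (\<lambda>f t. f + t * g) fs ts) \<subseteq> P \<longrightarrow> g \<in> P)"
  using assms
proof (induction k arbitrary: I fs)
  case 0
  have False if "prime_set P" "cst ` I \<subseteq> P" for P
    using dim_below_0[OF 0(1) prime_set_contraction[OF that(1)]] that
      prime_set_one[OF prime_set_contraction[OF that(1)]] by (auto simp: contraction_def)
  then show ?case by (intro exI[of _ "replicate (length fs) 0"]) auto
next
  case (Suc k)
  then obtain f fs' where fs: "fs = f # fs'" by (cases fs) auto
  note S = mult_closed_bimonic[where 'a = 'a]
  define C where "C = set (coeffs f)"
  define B where "B = torsion {1} I C"
  have "dim_below {1} (I \<union> C \<union> B) k" unfolding B_def
    by (rule dim_below_boundary[OF mult_closed_one Suc.prems(1)]) (simp add: C_def)
  moreover have len': "k \<le> length fs'" using Suc.prems fs by simp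
  ultimately obtain ts where ts: "length ts = length fs'" and
    tsP: "\<And>P. prime_set P \<Longrightarrow> P \<inter> bimonic = {} \<Longrightarrow> cst ` (I \<union> C \<union> B) \<subseteq> P \<Longrightarrow>
       set (map2 (\<lambda>f t. f + t * g) fs' ts) \<subseteq> P \<Longrightarrow> g \<in> P" using Suc.IH by meson
  define fs1 where "fs1 = map2 (\<lambda>f t. f + t * g) fs' ts"
  have len1: "length fs1 = length fs'" using ts by (simp add: fs1_def)
  obtain s n where s: "s \<in> bimonic" and "s * g ^ n \<in> idl (cst ` (I \<union> C \<union> B) \<union> set fs1)"
    using radical_member[OF S, of "cst ` (I \<union> C \<union> B) \<union> set fs1" g] tsP unfolding fs1_def
    by (metis (no_types, lifting) Un_subset_iff)
  then have "s * g ^ n \<in> idl ((cst ` I \<union> set fs1 \<union> cst ` C) \<union> cst ` B)"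
    by (simp add: image_Un Un_ac)
  then obtain w y where w: "w \<in> idl (cst ` I \<union> set fs1 \<union> cst ` C)" and y: "y \<in> idl (cst ` B)"
    and eq: "s * g ^ n = w + y" by (rule idl_UnE)
  have y_tors: "y \<in> P" if P: "prime_set P" "cst ` I \<subseteq> P" and c: "c \<in> C" "cst c \<notin> P" for P c
  proof (rule prime_set_idlD[OF P(1) y])
    have "b \<in> contraction P" if "b \<in> B" for b
      using torsion_prime[OF prime_set_contraction[OF P(1)] _ _ that[unfolded B_def] c(1)] c(2) P
        prime_set_one[OF prime_set_contraction[OF P(1)]] by (auto simp: contraction_def)
    then show "cst ` B \<subseteq> P" by (auto simp: contraction_def)
  qed
  have fC: "f \<in> idl (cst ` C)"
  proof (rule poly_in_idl)
    fix i show "coeff f i \<in> idl C"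
      using coeff_in_coeffs[of f i] le_degree[of f i]
      by (cases "coeff f i = 0"; cases "f = 0") (auto simp: C_def idl.zero intro!: idl.base)
  qed
  obtain gs where gs: "set gs = cst ` C" by (metis C_def list.set_map)
  \<comment> \<open>The open set of primes that do not contain \<open>C\<close>, intersected with \<open>V(f)\<close>.\<close>
  have "dim_below {s * h ^ n | s n. s \<in> bimonic} (insert f (cst ` I)) k" if "h \<in> set gs" for h
    using dim_below_generic_fibre[OF Suc.prems(1)] that by (auto simp: gs C_def)
  from stable_range_off[OF S this, of gs fs1 g] obtain vs where
    vs: "length vs = length fs1" "set vs \<subseteq> idl (cst ` C)" and
    vsP: "\<And>P. prime_set P \<Longrightarrow> P \<inter> bimonic = {} \<Longrightarrow> insert f (cst ` I) \<subseteq> P \<Longrightarrow> \<not> cst ` C \<subseteq> P \<Longrightarrow>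
       set (map2 (\<lambda>b v. b + v * g) fs1 vs) \<subseteq> P \<Longrightarrow> g \<in> P" using len' len1 unfolding gs by (metis (lifting))
  define us where "us = map2 (+) ts vs"
  have lu: "length us = length fs'" using ts vs len1 by (simp add: us_def)
  have fs2: "map2 (\<lambda>f t. f + t * g) fs' us = map2 (\<lambda>b v. b + v * g) fs1 vs"
    using ts vs len1 by (intro nth_equalityI) (auto simp: us_def fs1_def algebra_simps)
  have fin: "g \<in> P" if P: "prime_set P" "P \<inter> bimonic = {}" "cst ` I \<subseteq> P"
    "set (map2 (\<lambda>f t. f + t * g) fs (y # us)) \<subseteq> P" for P
  proof -
    have fy: "f + y * g \<in> P" and rest: "set (map2 (\<lambda>b v. b + v * g) fs1 vs) \<subseteq> P"
      using P(4) fs unfolding fs2[symmetric] by auto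
    show ?thesis
    proof (cases "cst ` C \<subseteq> P")
      case False
      then obtain c where "c \<in> C" "cst c \<notin> P" by blast
      then have "y \<in> P" using y_tors P by blast
      then have "f \<in> P" using fy prime_set_add_cancel[OF P(1)] prime_set_mult_right[OF P(1)] by blast
      then show ?thesis using vsP[OF P(1,2) _ False rest] P(3) by blast
    next
      case True
      have "f \<in> P" using prime_set_idlD[OF P(1) fC True] .
      then have yg: "y * g \<in> P" using fy prime_set_add_cancel[OF P(1), of "y * g" f] by (simp add: add.commute)
      have "set fs1 \<subseteq> P"
      proof
        fix x assume "x \<in> set fs1"
        then obtain i where i: "i < length fs1" "x = fs1 ! i" by (auto simp: in_set_conv_nth)
        then have "x + vs ! i * g \<in> P" using vs subsetD[OF rest nth_mem[of i]] by simp
        moreover have "vs ! i \<in> P" using i(1) vs prime_set_idl[OF P(1) True] nth_mem[of i vs] by (metis subsetD)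
        ultimately show "x \<in> P" using prime_set_add_cancel[OF P(1)] prime_set_mult_right[OF P(1)] by blast
      qed
      then have "w \<in> P" using True P prime_set_idlD[OF P(1) w] by auto
      then show ?thesis
        using yg s P(2) eq prime_set_add[OF P(1), of w y] prime_set_mult_iff[OF P(1)] prime_set_power[OF P(1)]
        by (metis disjoint_iff)
    qed
  qed
  have "length (y # us) = length fs" using lu fs by simp
  then show ?case by (intro exI[of _ "y # us"] conjI allI impI) (assumption, rule fin)
qed

section \<open>Division by monic polynomials and norms\<close>

text \<open>
  For a prime \<open>J\<close> this is the ideal \<open>J[X]\<close>, so that \<open>f \<in> extension J\<close> means that \<open>f\<close> vanishes
  modulo \<open>J\<close>.
\<close>

definition extension :: "'a :: comm_ring_1 set \<Rightarrow> 'a poly set" where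
  "extension J = {f. \<forall>i. coeff f i \<in> J}"

context
  fixes P :: "'a :: comm_ring_1 set"
  assumes P: "prime_set P"
begin

lemma extension_zero: "0 \<in> extension P"
  using prime_set_zero[OF P] by (simp add: extension_def)

lemma extension_add: "f \<in> extension P \<Longrightarrow> g \<in> extension P \<Longrightarrow> f + g \<in> extension P"
  by (simp add: extension_def prime_set_add[OF P])

lemma extension_uminus: "f \<in> extension P \<Longrightarrow> - f \<in> extension P"
  by (simp add: extension_def prime_set_uminus[OF P])

lemma extension_mult: "f \<in> extension P \<Longrightarrow> g * f \<in> extension P"
  unfolding extension_def coeff_mult mem_Collect_eq
  by (intro allI prime_set_sum[OF P] prime_set_mult[OF P]) auto

lemma extension_sum: "(\<And>i. i \<in> A \<Longrightarrow> f i \<in> extension P) \<Longrightarrow> sum f A \<in> extension P"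
  by (induction A rule: infinite_finite_induct) (auto simp: extension_zero extension_add)

lemma idl_extension: "z \<in> idl S \<Longrightarrow> S \<subseteq> extension P \<Longrightarrow> z \<in> extension P"
  by (induction rule: idl.induct) (auto simp: extension_zero extension_add extension_mult)

end

lemma monic_division:
  fixes w :: "'a :: comm_ring_1 poly"
  assumes "lead_coeff w = 1" "0 < degree w"
  obtains q r where "f = w * q + r" "degree r < degree w"
  using pseudo_division[OF assms(2), of f] assms(1) by auto

definition mrem :: "'a :: comm_ring_1 poly \<Rightarrow> 'a poly \<Rightarrow> 'a poly" where
  "mrem w f = (SOME r. \<exists>q. f = w * q + r \<and> degree r < degree w)"

text \<open>
  Multiplication by \<open>f\<close> on \<open>R[X]/(w)\<close>, in the basis of the powers of \<open>X\<close>, for monic \<open>w\<close>; its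
  determinant is the norm of \<open>f\<close>.
\<close>

definition mult_mat :: "'a :: comm_ring_1 poly \<Rightarrow> 'a poly \<Rightarrow> 'a mat" where
  "mult_mat w f = mat (degree w) (degree w) (\<lambda>(i, j). coeff (mrem w (f * monom 1 j)) i)"

context
  fixes w :: "'a :: comm_ring_1 poly"
  assumes monic: "lead_coeff w = 1" and pos: "0 < degree w"
begin

lemma mrem_decomp: obtains q where "f = w * q + mrem w f" "degree (mrem w f) < degree w"
proof -
  have "\<exists>r q. f = w * q + r \<and> degree r < degree w" using monic_division[OF monic pos] by metis
  then have "\<exists>q. f = w * q + mrem w f \<and> degree (mrem w f) < degree w" unfolding mrem_def by (rule someI_ex)
  then show thesis using that by blast
qed

lemma degree_mrem: "degree (mrem w f) < degree w"
  using mrem_decomp by blast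

lemma monic_mult_degree_less: "degree (w * q) < degree w \<Longrightarrow> q = 0"
proof (rule ccontr)
  assume deg: "degree (w * q) < degree w" and "q \<noteq> 0"
  then have "coeff (w * q) (degree w + degree q) \<noteq> 0" using monic by (simp add: coeff_mult_degree_sum)
  then show False using le_degree deg by fastforce
qed

lemma mrem_eqI:
  assumes "f = w * q + r" "degree r < degree w"
  shows "mrem w f = r"
proof -
  obtain q' where q': "f = w * q' + mrem w f" using mrem_decomp[of f] by blast
  have "w * (q' - q) = r - mrem w f" using assms(1) q' by (simp add: algebra_simps)
  moreover have "degree (r - mrem w f) < degree w" using degree_mrem assms(2) by (rule degree_diff_less[rotated])
  ultimately have "q' - q = 0" using monic_mult_degree_less by metis
  then show ?thesis using q' assms(1) by simp
qed

lemma mrem_id: "degree f < degree w \<Longrightarrow> mrem w f = f"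
  by (rule mrem_eqI[of _ 0]) auto

lemma mrem_multiple: "mrem w (w * q) = 0"
  by (rule mrem_eqI[of _ q]) (use pos in auto)

lemma mrem_add: "mrem w (f + g) = mrem w f + mrem w g"
proof -
  obtain q q' where "f = w * q + mrem w f" "g = w * q' + mrem w g" using mrem_decomp by metis
  then have "f + g = (w * q + mrem w f) + (w * q' + mrem w g)" by metis
  also have "\<dots> = w * (q + q') + (mrem w f + mrem w g)" by (simp add: algebra_simps)
  finally show ?thesis by (rule mrem_eqI) (intro degree_add_less degree_mrem)
qed

lemma mrem_smult: "mrem w (smult c f) = smult c (mrem w f)"
proof -
  obtain q where "f = w * q + mrem w f" using mrem_decomp by metis
  then have "smult c f = w * smult c q + smult c (mrem w f)" by (metis mult_smult_right smult_add_right)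
  then show ?thesis by (rule mrem_eqI) (intro le_less_trans[OF degree_smult_le] degree_mrem)
qed

lemma mrem_sum: "mrem w (sum f A) = (\<Sum>i\<in>A. mrem w (f i))"
  using mrem_id[of 0] pos by (induction A rule: infinite_finite_induct) (auto simp: mrem_add)

lemma mrem_mult_mrem: "mrem w (f * mrem w g) = mrem w (f * g)"
proof -
  obtain q where "g = w * q + mrem w g" using mrem_decomp by metis
  then have "f * g = w * (f * q) + f * mrem w g" by (metis distrib_left mult.left_commute)
  then show ?thesis by (simp add: mrem_add mrem_multiple)
qed

lemma mrem_expand: "mrem w (f * p) = (\<Sum>j\<le>degree p. smult (coeff p j) (mrem w (f * monom 1 j)))"
proof -
  have "f * p = f * (\<Sum>j\<le>degree p. monom (coeff p j) j)" unfolding poly_as_sum_of_monoms ..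
  also have "\<dots> = (\<Sum>j\<le>degree p. smult (coeff p j) (f * monom 1 j))"
    unfolding sum_distrib_left
    by (intro sum.cong) (metis mult.right_neutral mult_smult_right smult_monom)+
  finally have "mrem w (f * p) = mrem w (\<Sum>j\<le>degree p. smult (coeff p j) (f * monom 1 j))" by (rule arg_cong)
  then show ?thesis unfolding mrem_sum mrem_smult .
qed

lemma mrem_extension:
  assumes P: "prime_set P" and "f \<in> extension P"
  shows "mrem w f \<in> extension P"
proof -
  have "mrem w f = mrem w (1 * f)" by simp
  also have "\<dots> \<in> extension P" unfolding mrem_expand[of 1 f]
    using assms(2) by (intro extension_sum[OF P]) (auto simp: extension_def prime_set_mult_right[OF P])
  finally show ?thesis .
qed

lemma mult_mat_carrier: "mult_mat w f \<in> carrier_mat (degree w) (degree w)"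
  by (simp add: mult_mat_def)

lemma mult_mat_vec:
  assumes "degree p < degree w" "i < degree w"
  shows "(\<Sum>j<degree w. mult_mat w f $$ (i, j) * coeff p j) = coeff (mrem w (f * p)) i"
proof -
  have "coeff (mrem w (f * p)) i = (\<Sum>j\<le>degree p. coeff p j * coeff (mrem w (f * monom 1 j)) i)"
    by (simp add: mrem_expand[of f p] coeff_sum)
  also have "\<dots> = (\<Sum>j<degree w. coeff p j * coeff (mrem w (f * monom 1 j)) i)"
    using assms(1) by (intro sum.mono_neutral_left) (auto simp: coeff_eq_0)
  finally show ?thesis using assms(2) by (simp add: mult_mat_def mult.commute)
qed

lemma mult_mat_mult: "mult_mat w f * mult_mat w g = mult_mat w (f * g)"
proof (rule eq_matI)
  fix i j assume ij: "i < dim_row (mult_mat w (f * g))" "j < dim_col (mult_mat w (f * g))"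
  then have ij': "i < degree w" "j < degree w" by (simp_all add: mult_mat_def)
  have "(mult_mat w f * mult_mat w g) $$ (i, j) = (\<Sum>l<degree w. mult_mat w f $$ (i, l) * mult_mat w g $$ (l, j))"
    using ij' by (simp add: mult_mat_def scalar_prod_def atLeast0LessThan)
  also have "\<dots> = (\<Sum>l<degree w. mult_mat w f $$ (i, l) * coeff (mrem w (g * monom 1 j)) l)"
    using ij' by (intro sum.cong) (auto simp: mult_mat_def)
  also have "\<dots> = coeff (mrem w (f * mrem w (g * monom 1 j))) i"
    by (rule mult_mat_vec[OF degree_mrem ij'(1)])
  also have "\<dots> = mult_mat w (f * g) $$ (i, j)"
    using ij' by (simp add: mrem_mult_mrem mult_mat_def mult.assoc)
  finally show "(mult_mat w f * mult_mat w g) $$ (i, j) = mult_mat w (f * g) $$ (i, j)" .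
qed (simp_all add: mult_mat_def)

text \<open>
  The norm is a multiple of \<open>f\<close> in \<open>R[X]/(w)\<close>: the first column of the adjugate matrix contains the
  coefficients of the cofactor.
\<close>

lemma norm_multiple: obtains h where "mrem w (f * h) = cst (det (mult_mat w f))"
proof -
  let ?M = "mult_mat w f" and ?m = "degree w"
  define A where "A = adj_mat ?M"
  have A: "A \<in> carrier_mat ?m ?m" "?M * A = det ?M \<cdot>\<^sub>m 1\<^sub>m ?m"
    using adj_mat[OF mult_mat_carrier[of f]] by (simp_all add: A_def)
  define h where "h = (\<Sum>j<?m. monom (A $$ (j, 0)) j)"
  have ch: "coeff h j = (if j < ?m then A $$ (j, 0) else 0)" for j
    unfolding h_def coeff_sum by (simp add: coeff_monom sum.delta if_distrib cong: if_cong)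
  have dh: "degree h < ?m"
    using pos by (intro degree_lessI) (auto simp: ch)
  have "coeff (mrem w (f * h)) i = coeff (cst (det ?M)) i" for i
  proof (cases "i < ?m")
    case True
    have "coeff (mrem w (f * h)) i = (\<Sum>j<?m. ?M $$ (i, j) * coeff h j)"
      using mult_mat_vec[OF dh True] by simp
    also have "\<dots> = (?M * A) $$ (i, 0)"
      using True pos A(1) mult_mat_carrier[of f] by (simp add: scalar_prod_def atLeast0LessThan ch)
    also have "\<dots> = coeff (cst (det ?M)) i"
      using True pos unfolding A(2) by (cases i) auto
    finally show ?thesis .
  next
    case False
    then show ?thesis using degree_mrem[of "f * h"] pos by (cases i) (auto simp: coeff_eq_0)
  qed
  then show thesis by (intro that[of h] poly_eqI)
qed

end

lemma prod_congruent:
  assumes P: "prime_set P" and "\<And>i. i \<in> A \<Longrightarrow> f i - g i \<in> P"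
  shows "prod f A - prod g A \<in> P"
  using assms(2)
proof (induction A rule: infinite_finite_induct)
  case (insert x A)
  have "prod f (insert x A) - prod g (insert x A) = prod f A * (f x - g x) + g x * (prod f A - prod g A)"
    using insert.hyps by (simp add: algebra_simps)
  also have "\<dots> \<in> P" using insert by (intro prime_set_add[OF P] prime_set_mult[OF P]) auto
  finally show ?case .
qed (simp_all add: prime_set_zero[OF P])

lemma det_congruent:
  assumes P: "prime_set P" and A: "A \<in> carrier_mat n n" "B \<in> carrier_mat n n"
    and "\<And>i j. i < n \<Longrightarrow> j < n \<Longrightarrow> A $$ (i, j) - B $$ (i, j) \<in> P"
  shows "det A - det B \<in> P"
proof -
  have "det A - det B = (\<Sum>p\<in>{p. p permutes {0..<n}}.
      signof p * ((\<Prod>i = 0..<n. A $$ (i, p i)) - (\<Prod>i = 0..<n. B $$ (i, p i))))"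
    by (simp add: det_def'[OF A(1)] det_def'[OF A(2)] sum_subtractf right_diff_distrib)
  also have "\<dots> \<in> P"
  proof (intro prime_set_sum[OF P] prime_set_mult[OF P] prod_congruent[OF P] assms(4))
    fix p i assume "p \<in> {p. p permutes {0..<n}}" "i \<in> {0..<n}"
    then show "p i < n" using permutes_in_image by fastforce
  qed auto
  finally show ?thesis .
qed

text \<open>
  If \<open>f\<close> is invertible in \<open>R[X]/(w)\<close> modulo \<open>P\<close>, then so is its norm modulo \<open>P\<close>, because the
  norm is multiplicative.
\<close>

lemma norm_not_in_prime:
  fixes w :: "'a :: comm_ring_1 poly"
  assumes w: "lead_coeff w = 1" "0 < degree w" and P: "prime_set P"
    and inv: "f * g - 1 - w * s \<in> extension P"
  shows "det (mult_mat w f) \<notin> P"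
proof
  assume d: "det (mult_mat w f) \<in> P"
  let ?m = "degree w"
  have "det (mult_mat w (f * g)) - det (1\<^sub>m ?m) \<in> P"
  proof (rule det_congruent[OF P mult_mat_carrier[OF w] one_carrier_mat])
    fix i j assume ij: "i < ?m" "j < ?m"
    have "f * g * monom 1 j = monom 1 j + (w * (s * monom 1 j) + monom 1 j * (f * g - 1 - w * s))"
      by (simp add: algebra_simps)
    moreover have "mrem w (monom 1 j) = monom 1 j"
      using ij by (intro mrem_id[OF w]) (simp add: degree_monom_eq)
    ultimately have "mrem w (f * g * monom 1 j) - monom 1 j = mrem w (monom 1 j * (f * g - 1 - w * s))"
      by (simp add: mrem_add[OF w] mrem_multiple[OF w])
    also have "\<dots> \<in> extension P" by (intro mrem_extension[OF w P] extension_mult[OF P] inv)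
    finally have "coeff (mrem w (f * g * monom 1 j) - monom 1 j) i \<in> P" by (simp add: extension_def)
    then show "mult_mat w (f * g) $$ (i, j) - 1\<^sub>m ?m $$ (i, j) \<in> P"
      using ij by (auto simp: mult_mat_def)
  qed
  moreover have "det (mult_mat w (f * g)) = det (mult_mat w f) * det (mult_mat w g)"
    unfolding mult_mat_mult[OF w, symmetric] by (rule det_mult[OF mult_mat_carrier[OF w] mult_mat_carrier[OF w]])
  ultimately have "det (mult_mat w f) * det (mult_mat w g) - 1 \<in> P" by simp
  then have "det (mult_mat w f) * det (mult_mat w g) - (det (mult_mat w f) * det (mult_mat w g) - 1) \<in> P"
    using prime_set_diff[OF P prime_set_mult_right[OF P d]] by blast
  then show False using prime_set_one[OF P] by simp
qed

section \<open>Rows with a monic entry\<close>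

lemma row_equiv_mrem:
  assumes w: "lead_coeff w = 1" "0 < degree w"
  shows "w # fs \<sim>\<^sub>E w # map (mrem w) fs"
proof -
  have "\<forall>f. \<exists>q. f = w * q + mrem w f" using mrem_decomp[OF w] by metis
  then obtain q where q: "\<And>f. f = w * q f + mrem w f" by metis
  have "w # fs \<sim>\<^sub>E w # map2 (\<lambda>f t. f + t * w) fs (map (\<lambda>f. - q f) fs)"
    by (rule row_equiv_add_tail) simp
  also have "map2 (\<lambda>f t. f + t * w) fs (map (\<lambda>f. - q f) fs) = map (mrem w) fs"
  proof (rule nth_equalityI)
    fix i assume "i < length (map2 (\<lambda>f t. f + t * w) fs (map (\<lambda>f. - q f) fs))"
    then have i: "i < length fs" by simp
    have "fs ! i + - q (fs ! i) * w = mrem w (fs ! i)"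
      using q[of "fs ! i"] by (metis add_diff_cancel_left' diff_conv_add_uminus minus_mult_left mult.commute)
    then show "map2 (\<lambda>f t. f + t * w) fs (map (\<lambda>f. - q f) fs) ! i = map (mrem w) fs ! i"
      using i by simp
  qed simp
  finally show ?thesis .
qed

text \<open>
  Multiplying \<open>p\<close> by \<open>X\<close> and reducing modulo \<open>w\<close> moves each coefficient up by one place, apart from
  a multiple of the old top coefficient, which can be corrected by a multiple of \<open>p\<close> itself.
\<close>

lemma coefficient_as_top_coefficient:
  fixes w :: "'a :: comm_ring_1 poly"
  assumes w: "lead_coeff w = 1" "degree w = Suc m" "w \<in> idl S"
    and "p \<in> idl S" "degree p \<le> m" "t \<le> m"
  shows "\<exists>z\<in>idl S. degree z \<le> m \<and> coeff z m = coeff p (m - t)"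
  using assms(4-)
proof (induction t arbitrary: p)
  case 0 then show ?case by auto
next
  case (Suc t)
  define p' where "p' = pCons 0 p - smult (coeff p m) w"
  have "pCons 0 p = monom 1 1 * p" by (simp add: monom_Suc)
  then have "pCons 0 p \<in> idl S" using idl.mult[OF Suc.prems(1)] by metis
  moreover have "smult (coeff p m) w \<in> idl S" using idl.mult[OF w(3), of "cst (coeff p m)"] by simp
  ultimately have "p' \<in> idl S" unfolding p'_def by (rule idl_diff)
  moreover have "degree p' \<le> m"
  proof -
    have "degree p' \<le> Suc m" unfolding p'_def using w(2) Suc.prems(2)
      by (intro degree_diff_le) (auto intro: order_trans[OF degree_pCons_le] order_trans[OF degree_smult_le])
    moreover have "coeff p' (Suc m) = 0" using w by (simp add: p'_def)
    ultimately show ?thesis using degree_less_if_lead_cancels[of p' "Suc m"] by simp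
  qed
  ultimately obtain z where z: "z \<in> idl S" "degree z \<le> m" "coeff z m = coeff p' (m - t)"
    using Suc.IH[of p'] Suc.prems by auto
  obtain n where n: "m - t = Suc n" "m - Suc t = n" using Suc.prems by (metis Suc_diff_Suc Suc_le_lessD)
  define z' where "z' = z + smult (coeff w (m - t)) p"
  have "smult (coeff w (m - t)) p \<in> idl S"
    using idl.mult[OF Suc.prems(1), of "cst (coeff w (m - t))"] by simp
  then have "z' \<in> idl S" unfolding z'_def using z by (intro idl.add)
  moreover have "degree z' \<le> m" unfolding z'_def using z Suc.prems
    by (intro degree_add_le) (auto intro: order_trans[OF degree_smult_le])
  moreover have "coeff z' m = coeff p (m - Suc t)"
    using z(3) n by (simp add: z'_def p'_def)
  ultimately show ?case by blast
qed

lemma content_as_top_coefficient: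
  fixes w :: "'a :: comm_ring_1 poly"
  assumes w: "lead_coeff w = 1" "degree w = Suc m" "w \<in> idl S"
    and F: "F \<subseteq> idl S" "\<And>p. p \<in> F \<Longrightarrow> degree p \<le> m"
    and c: "c \<in> idl {coeff p i | p i. p \<in> F}"
  shows "\<exists>z\<in>idl S. degree z \<le> m \<and> coeff z m = c"
  using c
proof induction
  case zero show ?case by (intro bexI[of _ 0]) (auto intro: idl.zero)
next
  case (base a)
  then obtain p i where a: "a = coeff p i" "p \<in> F" by blast
  show ?case
  proof (cases "i \<le> m")
    case True
    then show ?thesis using coefficient_as_top_coefficient[OF w, of p "m - i"] a F by auto
  next
    case False
    then have "a = 0" using a F(2)[of p] by (auto simp: coeff_eq_0)
    then show ?thesis by (intro bexI[of _ 0]) (auto intro: idl.zero)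
  qed
next
  case (add a b)
  then obtain y z where "y \<in> idl S" "degree y \<le> m" "coeff y m = a" "z \<in> idl S" "degree z \<le> m" "coeff z m = b" by blast
  then show ?case by (intro bexI[of _ "y + z"]) (auto intro: idl.add degree_add_le)
next
  case (mult a r)
  then obtain y where "y \<in> idl S" "degree y \<le> m" "coeff y m = a" by blast
  then show ?case using idl.mult[of y S "cst r"]
    by (intro bexI[of _ "smult r y"]) (auto intro: order_trans[OF degree_smult_le])
qed

lemma prime_set_evaluation:
  assumes P: "prime_set P"
  shows "prime_set {g. poly g r \<in> P}"
  by (rule prime_set_vimage[where h = "\<lambda>g. poly g r", OF P]) simp_all

text \<open>
  Constants are unchanged by evaluation at the root of \<open>w\<close>, which removes \<open>w\<close> from a relation of
  unimodularity.
\<close>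

lemma linear_monic_row:
  fixes w :: "'a :: comm_ring_1 poly"
  assumes w: "lead_coeff w = 1" "degree w = 1" and uni: "1 \<in> idl (set (w # map cst cs))"
  shows "1 \<in> idl (set (map cst cs))"
proof (rule one_in_idlI)
  fix Q assume Q: "prime_set Q" "set (map cst cs) \<subseteq> Q"
  define P where "P = contraction Q"
  have P: "prime_set P" unfolding P_def by (rule prime_set_contraction[OF Q(1)])
  define r where "r = - coeff w 0"
  have "w = [:coeff w 0, 1:]"
  proof (rule poly_eqI)
    fix n show "coeff w n = coeff [:coeff w 0, 1:] n"
      using w by (cases n; cases "n - 1") (auto simp: coeff_eq_0)
  qed
  then have "poly w r = 0" unfolding r_def by (metis add.right_inverse mult.right_neutral mult_zero_right poly_0 poly_pCons add.right_neutral)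
  then have "set (w # map cst cs) \<subseteq> {g. poly g r \<in> P}"
    using Q(2) prime_set_zero[OF P] by (auto simp: P_def contraction_def)
  then have "1 \<in> {g. poly g r \<in> P}" using prime_set_idlD[OF prime_set_evaluation[OF P] uni] by blast
  then show False using prime_set_one[OF P] by simp
qed

text \<open>
  Consider a prime \<open>P\<close> of \<open>R\<close> at which all modified entries \<open>g + t f\<close> vanish modulo \<open>w\<close>. By
  unimodularity \<open>f\<close> is invertible in \<open>R[X]/(w)\<close> modulo \<open>P\<close>, so its norm \<open>a\<close> is not in \<open>P\<close>. On the
  other hand, let \<open>f h = a\<close> in \<open>R[X]/(w)\<close>. The coefficients of \<open>(g + t f) h = g h + a t\<close> vanish,
  and as those of \<open>t\<close> can be chosen independently of each other, the stable range theorem for \<open>R\<close>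
  provides \<open>t\<close> for which this forces \<open>a \<in> P\<close>. There are \<open>deg w\<close> parameters for each entry, which
  makes up for the one entry \<open>f\<close> that is not modified.
\<close>

lemma unimodular_content:
  fixes w f :: "'a :: comm_ring_1 poly"
  assumes dim: "dim_below {1} ({} :: 'a set) k" and w: "lead_coeff w = 1" "2 \<le> degree w"
    and uni: "1 \<in> idl (set (w # f # fs))" and k: "k \<le> 2 * length fs"
  obtains ts where "length ts = length fs"
    "1 \<in> idl {coeff p i | p i. p \<in> set (map (mrem w) (map2 (\<lambda>g t. g + t * f) fs ts))}"
proof -
  have pos: "0 < degree w" using w(2) by simp
  note w' = w(1) pos
  let ?m = "degree w" and ?l = "length fs"
  define a where "a = det (mult_mat w f)"
  obtain h where h: "mrem w (f * h) = cst a" using norm_multiple[OF w'] unfolding a_def by metis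
  define b where "b = (\<lambda>(i, j). coeff (mrem w (fs ! i * h)) j)"
  have "k \<le> card ({..<?l} \<times> {..<?m})"
    unfolding card_cartesian_product card_lessThan
    using k mult_le_mono2[OF w(2), of ?l] by linarith
  from stable_range_indexed[OF mult_closed_one dim _ this, of b a]
  obtain u where u: "\<And>P. prime_set P \<Longrightarrow> P \<inter> {1} = {} \<Longrightarrow> {} \<subseteq> P \<Longrightarrow>
    (\<And>x. x \<in> {..<?l} \<times> {..<?m} \<Longrightarrow> b x + u x * a \<in> P) \<Longrightarrow> a \<in> P" by auto
  define t where "t = (\<lambda>i. \<Sum>j<?m. monom (u (i, j)) j)"
  have ct: "coeff (t i) j = (if j < ?m then u (i, j) else 0)" for i j
    unfolding t_def coeff_sum by (simp add: coeff_monom sum.delta if_distrib cong: if_cong)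
  have dt: "degree (t i) < ?m" for i using pos by (intro degree_lessI) (auto simp: ct)
  define ts where "ts = map t [0..<?l]"
  define gs where "gs = map2 (\<lambda>g t. g + t * f) fs ts"
  have lts: "length ts = ?l" by (simp add: ts_def)
  have gs_nth: "gs ! i = fs ! i + t i * f" if "i < ?l" for i
    using that by (simp add: gs_def ts_def)
  have lgs: "length gs = ?l" by (simp add: gs_def ts_def)
  have "w # f # fs \<sim>\<^sub>E w # f # gs" unfolding gs_def by (rule row_equiv_add_tail_second[OF lts])
  also have "\<dots> \<sim>\<^sub>E w # map (mrem w) (f # gs)" by (rule row_equiv_mrem[OF w'])
  finally have "1 \<in> idl (set (w # map (mrem w) (f # gs)))" using row_equiv_idl uni by metis
  then have "1 \<in> idl (insert w (insert (mrem w f) (set (map (mrem w) gs))))" by simp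
  then obtain s y g z where y: "1 = s * w + y" "y = g * mrem w f + z" and z: "z \<in> idl (set (map (mrem w) gs))"
    by (metis idl_insertE)
  obtain q where q: "f = w * q + mrem w f" using mrem_decomp[OF w'] by metis
  show thesis
  proof (rule that[OF lts], rule one_in_idlI)
    fix P assume P: "prime_set P" and sub: "{coeff p i | p i. p \<in> set (map (mrem w) (map2 (\<lambda>g t. g + t * f) fs ts))} \<subseteq> P"
    have ext: "mrem w g \<in> extension P" if "g \<in> set gs" for g
      using sub that unfolding gs_def[symmetric] extension_def by auto
    have "b x + u x * a \<in> P" if "x \<in> {..<?l} \<times> {..<?m}" for x
    proof -
      obtain i j where x: "x = (i, j)" "i < ?l" "j < ?m" using \<open>x \<in> _\<close> by auto
      have "mrem w (t i * f * h) = mrem w (t i * mrem w (f * h))"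
        by (simp add: mrem_mult_mrem[OF w'] mult.assoc)
      also have "\<dots> = smult a (t i)"
        using mrem_id[OF w' dt] by (simp add: h mrem_smult[OF w'])
      finally have "mrem w (gs ! i * h) = mrem w (fs ! i * h) + smult a (t i)"
        by (simp add: gs_nth[OF x(2)] distrib_right mrem_add[OF w'])
      then have "coeff (mrem w (gs ! i * h)) j = b x + u x * a"
        using x by (simp add: b_def ct mult.commute)
      moreover have "mrem w (gs ! i * h) = mrem w (h * mrem w (gs ! i))"
        by (simp add: mrem_mult_mrem[OF w'] mult.commute)
      then have "mrem w (gs ! i * h) \<in> extension P"
        using ext[of "gs ! i"] x(2) lgs by (simp add: mrem_extension[OF w' P] extension_mult[OF P])
      ultimately show ?thesis by (metis (mono_tags) extension_def mem_Collect_eq)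
    qed
    then have aP: "a \<in> P" using u[OF P] prime_set_one[OF P] by blast
    have "z \<in> extension P" using z ext by (intro idl_extension[OF P z]) auto
    moreover have "f * g - 1 - w * (q * g - s) = - z"
    proof -
      have "1 = s * w + (g * (f - w * q) + z)" using y q by (metis add_diff_cancel_left')
      then show ?thesis by (simp add: algebra_simps)
    qed
    ultimately have "f * g - 1 - w * (q * g - s) \<in> extension P" using extension_uminus[OF P] by simp
    then have "a \<notin> P" unfolding a_def by (rule norm_not_in_prime[OF w' P])
    then show False using aP by blast
  qed
qed

text \<open>
  Induction on the degree of the monic entry. In degree one the remainders modulo \<open>w\<close> are constants
  and there is nothing left to do; in higher degree the second entry becomes monic of degree one
  less and takes the place of \<open>w\<close>. Two entries besides \<open>w\<close> are needed for this.
\<close>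

theorem monic_row_equiv_e1:
  fixes w :: "'a :: comm_ring_1 poly"
  assumes dim: "dim_below {1} ({} :: 'a set) k"
    and "lead_coeff w = 1" "1 \<in> idl (set (w # fs))" "k \<le> length fs" "2 \<le> length fs"
  shows "w # fs \<sim>\<^sub>E e1 (length fs)"
  using assms(2-)
proof (induction "degree w" arbitrary: w fs rule: less_induct)
  case less
  note w = less.prems(1)
  consider "degree w = 0" | "degree w = 1" | "2 \<le> degree w" by linarith
  then show ?case
  proof cases
    case 1
    then have "w = 1" using w by (metis degree_0_id one_pCons)
    then show ?thesis using row_equiv_clear_tail[of fs 1] idl_one[OF idl.base[of 1 "{1}"]] by auto
  next
    case 2
    then have pos: "0 < degree w" by simp
    define cs where "cs = map (\<lambda>f. coeff (mrem w f) 0) fs"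
    have "mrem w f = cst (coeff (mrem w f) 0)" for f
      using degree_mrem[OF w pos, of f] 2 by (metis degree_0_id less_one)
    then have cs: "map (mrem w) fs = map cst cs" by (simp add: cs_def)
    have eq: "w # fs \<sim>\<^sub>E w # map cst cs" using row_equiv_mrem[OF w pos, of fs] cs by simp
    then have "1 \<in> idl (set (map cst cs))"
      using row_equiv_idl[OF eq] less.prems(2) by (intro linear_monic_row[OF w 2]) auto
    then have "w # map cst cs \<sim>\<^sub>E e1 (length (map cst cs))" by (rule row_equiv_e1_if_tail)
    then show ?thesis using row_equiv_trans'[OF eq] by (simp add: cs_def)
  next
    case 3
    then have pos: "0 < degree w" by simp
    obtain f fs' where fs: "map (mrem w) fs = f # fs'" using less.prems(4) by (cases fs) auto
    have lf: "length fs = Suc (length fs')" using arg_cong[OF fs, of length] by simp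
    have "f \<in> set (map (mrem w) fs)" using fs by simp
    then have df: "degree f < degree w" using degree_mrem[OF w pos] by auto
    have eq1: "w # fs \<sim>\<^sub>E w # f # fs'" using row_equiv_mrem[OF w pos, of fs] fs by simp
    have uni1: "1 \<in> idl (set (w # f # fs'))" using row_equiv_idl[OF eq1] less.prems(2) by simp
    obtain ts where ts: "length ts = length fs'" and
      cont: "1 \<in> idl {coeff p i | p i. p \<in> set (map (mrem w) (map2 (\<lambda>g t. g + t * f) fs' ts))}"
      using unimodular_content[OF dim w 3 uni1] less.prems(3,4) lf by auto
    define gs where "gs = map (mrem w) (map2 (\<lambda>g t. g + t * f) fs' ts)"
    have fm: "mrem w f = f" by (rule mrem_id[OF w pos df])
    have "w # f # fs' \<sim>\<^sub>E w # f # map2 (\<lambda>g t. g + t * f) fs' ts"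
      by (rule row_equiv_add_tail_second[OF ts])
    also have "\<dots> \<sim>\<^sub>E w # map (mrem w) (f # map2 (\<lambda>g t. g + t * f) fs' ts)"
      by (rule row_equiv_mrem[OF w pos])
    also have "\<dots> = w # f # gs" by (simp add: gs_def fm)
    also have "\<dots> \<sim>\<^sub>E f # (- w) # gs" by (rule row_equiv_swap)
    finally have eq2: "w # f # fs' \<sim>\<^sub>E f # (- w) # gs" .
    obtain m where m: "degree w = Suc m" using pos by (cases "degree w") auto
    have "\<exists>z\<in>idl (set (- w # gs)). degree z \<le> m \<and> coeff z m = 1 - coeff f m"
    proof (rule content_as_top_coefficient[OF w m])
      show "w \<in> idl (set (- w # gs))"
        using idl_uminus[OF idl.base[of "- w" "set (- w # gs)"]] by simp
      show "set gs \<subseteq> idl (set (- w # gs))" by (auto intro: idl.base)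
      show "degree p \<le> m" if "p \<in> set gs" for p
        using that degree_mrem[OF w pos] m unfolding gs_def by (auto simp: less_Suc_eq_le)
      show "1 - coeff f m \<in> idl {coeff p i | p i. p \<in> set gs}"
        using idl_one[OF cont] unfolding gs_def .
    qed
    then obtain z where z: "z \<in> idl (set (- w # gs))" "degree z \<le> m" "coeff z m = 1 - coeff f m" by blast
    have eq3: "f # (- w) # gs \<sim>\<^sub>E (f + z) # (- w) # gs" by (rule row_equiv_add_head[OF z(1)])
    have cf: "coeff (f + z) m = 1" using z by simp
    have "degree (f + z) \<le> m" using df m z by (intro degree_add_le) auto
    then have dfz: "degree (f + z) = m" using cf le_degree[of "f + z" m] by simp
    have eq: "w # fs \<sim>\<^sub>E (f + z) # (- w) # gs"
      using row_equiv_trans'[OF row_equiv_trans'[OF eq1 eq2] eq3] .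
    have "length gs = length fs'" using ts by (simp add: gs_def)
    have "(f + z) # (- w # gs) \<sim>\<^sub>E e1 (length (- w # gs))"
    proof (rule less.hyps)
      show "degree (f + z) < degree w" using dfz m by simp
      show "lead_coeff (f + z) = 1" using dfz cf by simp
      show "1 \<in> idl (set ((f + z) # - w # gs))" using row_equiv_idl[OF eq] less.prems(2) by simp
      show "k \<le> length (- w # gs)" "2 \<le> length (- w # gs)"
        using \<open>length gs = length fs'\<close> lf less.prems(3,4) by simp_all
    qed
    then show ?thesis using row_equiv_trans'[OF eq] \<open>length gs = length fs'\<close> lf by simp
  qed
qed

section \<open>Rings of dimension zero\<close>

text \<open>
  In a ring of dimension zero the boundary of \<open>V(b)\<close> is empty, so \<open>V(b)\<close> is open and closed.
\<close>

lemma zero_dim_idempotent: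
  fixes b :: "'a :: comm_ring_1"
  assumes dim: "dim_below {1} ({} :: 'a set) 1"
  obtains e x where "e * e = e" "\<And>P. prime_set P \<Longrightarrow> b \<in> P \<Longrightarrow> e \<in> P"
    "\<And>P. prime_set P \<Longrightarrow> e \<in> P \<Longrightarrow> b \<in> P"
    "\<And>P. prime_set P \<Longrightarrow> e \<notin> P \<Longrightarrow> x * b - 1 \<in> P"
proof -
  let ?T = "torsion {1} {} {b}"
  have "dim_below {1} ({} \<union> {b} \<union> ?T) 0"
    by (rule dim_below_boundary[OF mult_closed_one]) (use dim in simp_all)
  then have "1 \<in> idl (insert b ?T)"
    using dim_below_0[of "{1}" "{} \<union> {b} \<union> ?T"] prime_set_one by (intro one_in_idlI) auto
  then obtain x y where y: "y \<in> idl ?T" and one: "1 = x * b + y" by (rule idl_insertE)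
  have "y \<in> ?T" using y idl_torsion[OF mult_closed_one] by blast
  then obtain n where n: "b ^ n * y = 0" unfolding torsion_def using idl_empty by fastforce
  \<comment> \<open>The exponent is positive so that \<open>e\<close> vanishes wherever \<open>b\<close> does, even if \<open>n = 0\<close>.\<close>
  define e where "e = (x * b) ^ Suc n"
  have "e * y = x ^ Suc n * b * (b ^ n * y)" by (simp add: e_def power_mult_distrib ac_simps)
  then have ey: "e * y = 0" using n by simp
  have y': "y = 1 - x * b" using one by (simp add: algebra_simps)
  have exb: "e * (x * b) = e" using ey unfolding y' by (simp add: algebra_simps)
  have "e * (x * b) ^ k = e" for k
  proof (induction k)
    case (Suc k)
    have "e * (x * b) ^ Suc k = (e * (x * b) ^ k) * (x * b)" by (simp only: power_Suc2 mult.assoc)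
    then show ?case using Suc exb by simp
  qed simp
  then have idem: "e * e = e" by (metis e_def)
  show thesis
  proof (rule that[of e x, OF idem])
    fix P :: "'a set" assume P: "prime_set P"
    show "e \<in> P" if "b \<in> P"
      using that unfolding e_def power_Suc by (intro prime_set_mult_right[OF P] prime_set_mult[OF P])
    show "b \<in> P" if "e \<in> P"
    proof -
      have xb: "x * b \<in> P" using that unfolding e_def by (rule prime_set_power[OF P])
      have "b ^ n = b ^ n * (x * b) + b ^ n * y" using one by (metis distrib_left mult.right_neutral)
      then have "b ^ n \<in> P" using prime_set_mult[OF P xb, of "b ^ n"] n by simp
      then show "b \<in> P" by (rule prime_set_power[OF P])
    qed
    show "x * b - 1 \<in> P" if "e \<notin> P"
    proof -
      have "y \<in> P" using that ey prime_set_zero[OF P] prime_set_mult_iff[OF P, of e y] by auto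
      then show "x * b - 1 \<in> P" using prime_set_uminus[OF P, of y] by (simp add: y')
    qed
  qed
qed

text \<open>
  The idempotent \<open>w\<close> restricts attention to an open and closed part of \<open>Spec R\<close>, on which
  \<open>p\<close> and \<open>q\<close> bound the degrees of \<open>f\<close> and \<open>g\<close> modulo the primes. That part is split
  according to whether the top coefficient of the polynomial with the smaller bound vanishes. Where
  it is invertible, a division step lowers the bound of the other polynomial; where it vanishes, the
  bound of the polynomial itself is lowered.
\<close>

lemma zero_dim_euclid:
  fixes f g :: "'a :: comm_ring_1 poly"
  assumes dim: "dim_below {1} ({} :: 'a set) 1" and "w * w = w"
    and "\<And>P i. prime_set P \<Longrightarrow> w \<notin> P \<Longrightarrow> p \<le> i \<Longrightarrow> coeff f i \<in> P"
    and "\<And>P i. prime_set P \<Longrightarrow> w \<notin> P \<Longrightarrow> q \<le> i \<Longrightarrow> coeff g i \<in> P"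
  shows "\<exists>f' g'. [f, g] \<sim>\<^sub>E [f', g'] \<and> (\<forall>P. prime_set P \<longrightarrow> w \<notin> P \<longrightarrow> g' \<in> extension P)"
  using assms(2-)
proof (induction "p + q" arbitrary: p q f g w rule: less_induct)
  case less
  have key: "\<exists>f' g'. [f, g] \<sim>\<^sub>E [f', g'] \<and> (\<forall>P. prime_set P \<longrightarrow> w \<notin> P \<longrightarrow> g' \<in> extension P)"
    if pq: "p + q = p' + q'" "q' \<le> p'"
    and f: "\<And>P i. prime_set P \<Longrightarrow> w \<notin> P \<Longrightarrow> p' \<le> i \<Longrightarrow> coeff f i \<in> P"
    and g: "\<And>P i. prime_set P \<Longrightarrow> w \<notin> P \<Longrightarrow> q' \<le> i \<Longrightarrow> coeff g i \<in> P" for p' q' f g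
  proof (cases q')
    case 0
    then have "g \<in> extension P" if "prime_set P" "w \<notin> P" for P using g that by (simp add: extension_def)
    then show ?thesis using row_equiv.refl by blast
  next
    case (Suc m)
    then obtain n where n: "p' = Suc n" "m \<le> n" using pq by (cases p') auto
    obtain e x where e: "e * e = e" and e0: "\<And>P. prime_set P \<Longrightarrow> e \<in> P \<Longrightarrow> coeff g m \<in> P"
      and e1: "\<And>P. prime_set P \<Longrightarrow> e \<notin> P \<Longrightarrow> x * coeff g m - 1 \<in> P"
      using zero_dim_idempotent[OF dim] by metis
    define c where "c = monom (coeff f n * x) (n - m)"
    define f1 where "f1 = f - c * g"
    have f1: "coeff f1 i \<in> P" if P: "prime_set P" "w * e \<notin> P" and i: "n \<le> i" for P i
    proof -
      have we: "w \<notin> P" "e \<notin> P" using P prime_set_mult_iff[OF P(1)] by auto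
      have ci: "coeff f1 i = coeff f i - coeff f n * x * coeff g (i - (n - m))"
        using i by (simp add: f1_def c_def coeff_monom_mult)
      show ?thesis
      proof (cases "i = n")
        case True
        then have "i - (n - m) = m" using n by simp
        then have "coeff f1 i = - (coeff f n * (x * coeff g m - 1))" using ci True by (simp add: algebra_simps)
        then show ?thesis using e1[OF P(1) we(2)] prime_set_mult[OF P(1)] prime_set_uminus[OF P(1)] by auto
      next
        case False
        then have "coeff f i \<in> P" "coeff g (i - (n - m)) \<in> P"
          using f[OF P(1) we(1), of i] g[OF P(1) we(1), of "i - (n - m)"] i n Suc by auto
        then show ?thesis using ci prime_set_diff[OF P(1)] prime_set_mult[OF P(1)] by simp
      qed
    qed
    have "(w * e) * (w * e) = w * e" using e less.prems(1) by (metis mult.assoc mult.commute)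
    moreover have "coeff g i \<in> P" if "prime_set P" "w * e \<notin> P" "q' \<le> i" for P i
      using that g prime_set_mult_iff by blast
    ultimately obtain f2 g2 where 2: "[f1, g] \<sim>\<^sub>E [f2, g2]"
      "\<And>P. prime_set P \<Longrightarrow> w * e \<notin> P \<Longrightarrow> g2 \<in> extension P"
      using less.hyps[of n q' "w * e" f1 g] f1 pq(1) n by auto
    have "[f, g] \<sim>\<^sub>E [f1, g]"
      using row_equiv_add_head[of "- (c * g)" "[g]" f] idl_uminus[OF idl.mult[OF idl.base[of g "{g}"]]]
      by (simp add: f1_def)
    then have eq2: "[f, g] \<sim>\<^sub>E [f2, g2]" using 2(1) row_equiv_trans' by blast
    have "(w * (1 - e)) * (w * (1 - e)) = (w * w) * (1 - e - e + e * e)" by (simp add: algebra_simps)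
    then have "(w * (1 - e)) * (w * (1 - e)) = w * (1 - e)" using e less.prems(1) by simp
    moreover have "coeff f i \<in> P" if "prime_set P" "w * (1 - e) \<notin> P" "p' \<le> i" for P i
      using that f prime_set_mult_iff by blast
    moreover have "coeff g i \<in> P" if P: "prime_set P" "w * (1 - e) \<notin> P" "m \<le> i" for P i
    proof (cases "i = m")
      case True
      have "e * (1 - e) = 0" using e by (simp add: algebra_simps)
      then have "e \<in> P" using P(2) prime_set_mult_iff[OF P(1)] prime_set_zero[OF P(1)] by metis
      then show ?thesis using e0[OF P(1)] True by simp
    next
      case False
      then show ?thesis using P g[OF P(1)] Suc prime_set_mult_iff[OF P(1)] by auto
    qed
    ultimately obtain f3 g3 where 3: "[f, g] \<sim>\<^sub>E [f3, g3]"
      "\<And>P. prime_set P \<Longrightarrow> w * (1 - e) \<notin> P \<Longrightarrow> g3 \<in> extension P"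
      using less.hyps[of p' m "w * (1 - e)" f g] pq(1) Suc by auto
    have "cst e * cst e = cst e" using e by (simp flip: cst_simps(2))
    from row_equiv_glue[OF this eq2 3(1)] have "[f, g] \<sim>\<^sub>E
      [cst e * f2 + (1 - cst e) * f3, cst e * g2 + (1 - cst e) * g3]" by simp
    moreover have "cst e * g2 + (1 - cst e) * g3 \<in> extension P" if P: "prime_set P" "w \<notin> P" for P
    proof -
      have c1: "(1 :: 'a poly) - cst e = cst (1 - e)" by (simp add: one_pCons)
      have "e * (1 - e) = 0" using e by (simp add: algebra_simps)
      then have e_cases: "e \<in> P \<or> 1 - e \<in> P" using prime_set_zero[OF P(1)] prime_set_mult_iff[OF P(1)] by metis
      have cext: "cst r * h \<in> extension P" if "r \<in> P" for r h
        using that prime_set_mult_right[OF P(1)] by (simp add: extension_def)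
      have e_not: "\<not> (e \<in> P \<and> 1 - e \<in> P)"
        using prime_set_add[OF P(1), of e "1 - e"] prime_set_one[OF P(1)] by auto
      from e_cases show ?thesis
      proof
        assume "e \<in> P"
        then have "w * (1 - e) \<notin> P" using e_not P prime_set_mult_iff[OF P(1)] by auto
        then show ?thesis
          using cext[OF \<open>e \<in> P\<close>] extension_mult[OF P(1) 3(2)[OF P(1)]] by (intro extension_add[OF P(1)])
      next
        assume "1 - e \<in> P"
        then have "w * e \<notin> P" using e_not P prime_set_mult_iff[OF P(1)] by auto
        then show ?thesis unfolding c1
          using cext[OF \<open>1 - e \<in> P\<close>] extension_mult[OF P(1) 2(2)[OF P(1)]] by (intro extension_add[OF P(1)])
      qed
    qed
    ultimately show ?thesis by blast
  qed
  show ?case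
  proof (cases "q \<le> p")
    case True
    then show ?thesis using key[of p q f g] less.prems by blast
  next
    case False
    have nf: "coeff (- f) i \<in> P" if "prime_set P" "w \<notin> P" "p \<le> i" for P i
      using less.prems(2)[OF that] prime_set_uminus[OF that(1)] by simp
    have "\<exists>f' g'. [g, - f] \<sim>\<^sub>E [f', g'] \<and> (\<forall>P. prime_set P \<longrightarrow> w \<notin> P \<longrightarrow> g' \<in> extension P)"
      using key[of q p g "- f", OF _ _ less.prems(3) nf] False by simp
    then show ?thesis using row_equiv_trans'[OF row_equiv_swap[of f g "[]"]] by blast
  qed
qed

section \<open>Polynomials inside Laurent polynomials\<close>

abbreviation lX :: "'a :: comm_ring_1 laurent_poly" where "lX \<equiv> Poly_Mapping.single 1 1"
abbreviation lXinv :: "'a :: comm_ring_1 laurent_poly" where "lXinv \<equiv> Poly_Mapping.single (-1) 1"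
abbreviation lconst :: "'a :: comm_ring_1 \<Rightarrow> 'a laurent_poly" where "lconst \<equiv> Poly_Mapping.single 0"

definition laurent :: "'a :: comm_ring_1 poly \<Rightarrow> 'a laurent_poly" where
  "laurent p = poly (map_poly lconst p) lX"

lemma lX_power: "lX ^ n = Poly_Mapping.single (int n) 1"
  by (induction n) (simp_all add: mult_single single_one)

lemma lX_inverse: "lX * lXinv = (1 :: 'a :: comm_ring_1 laurent_poly)"
  by (simp add: mult_single)

lemma lX_power_inverse: "lX ^ n * lXinv ^ n = (1 :: 'a :: comm_ring_1 laurent_poly)"
  by (metis lX_inverse power_mult_distrib power_one)

lemma laurent_pCons: "laurent (pCons a p) = lconst a + lX * laurent p"
  by (simp add: laurent_def map_poly_pCons)

lemma laurent_0 [simp]: "laurent 0 = 0" and laurent_1 [simp]: "laurent 1 = 1"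
  by (simp_all add: laurent_def)

lemma laurent_add: "laurent (p + q) = laurent p + laurent q"
  by (induction p q rule: poly_induct2) (simp_all add: laurent_pCons single_add algebra_simps)

lemma laurent_smult: "laurent (smult a p) = lconst a * laurent p"
  by (induction p) (simp_all add: laurent_pCons mult_single distrib_left mult.left_commute)

lemma laurent_mult: "laurent (p * q) = laurent p * laurent q"
  by (induction p) (simp_all add: laurent_pCons laurent_add laurent_smult distrib_right mult.assoc)

lemma laurent_monom: "laurent (monom 1 n) = lX ^ n"
  by (induction n) (simp_all add: monom_Suc laurent_pCons monom_0)

lemma row_equiv_laurent: "xs \<sim>\<^sub>E ys \<Longrightarrow> map laurent xs \<sim>\<^sub>E map laurent ys"
  by (rule row_equiv_map[where h = laurent, OF laurent_add laurent_mult])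

lemma lookup_laurent: "Poly_Mapping.lookup (laurent p) (int n) = coeff p n"
proof -
  have d: "degree (map_poly lconst p) = degree p" by (rule degree_map_poly) (metis lookup_single_eq lookup_zero)
  have "laurent p = (\<Sum>i\<le>degree p. Poly_Mapping.single (int i) (coeff p i))"
    unfolding laurent_def poly_altdef d by (simp add: coeff_map_poly lX_power mult_single)
  also have "Poly_Mapping.lookup \<dots> (int n) = (\<Sum>i\<le>degree p. if i = n then coeff p i else 0)"
    unfolding lookup_sum by (intro sum.cong) (auto simp: lookup_single when_def)
  also have "\<dots> = coeff p n" by (auto simp: coeff_eq_0)
  finally show ?thesis .
qed

lemma laurent_inject: "laurent p = laurent q \<Longrightarrow> p = q"
  by (metis lookup_laurent poly_eqI)

lemma laurent_sum_single: "z = (\<Sum>k\<in>Poly_Mapping.keys z. Poly_Mapping.single k (Poly_Mapping.lookup z k))"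
proof (rule poly_mapping_eqI)
  fix k
  have "(\<Sum>i\<in>Poly_Mapping.keys z. Poly_Mapping.lookup z i when i = k) = Poly_Mapping.lookup z k"
    by (simp add: when_def in_keys_iff)
  then show "Poly_Mapping.lookup z k = Poly_Mapping.lookup (\<Sum>k\<in>Poly_Mapping.keys z. Poly_Mapping.single k (Poly_Mapping.lookup z k)) k"
    by (simp add: lookup_sum lookup_single)
qed

lemma laurent_add_denominators:
  assumes "lX ^ n * x = laurent p" "lX ^ m * y = laurent q"
  shows "lX ^ (n + m) * (x + y) = laurent (monom 1 m * p + monom 1 n * q)"
proof -
  have "lX ^ (n + m) * (x + y) = lX ^ m * (lX ^ n * x) + lX ^ n * (lX ^ m * y)"
    by (simp add: power_add algebra_simps)
  then show ?thesis by (simp only: assms laurent_add laurent_mult laurent_monom)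
qed

lemma laurent_clear_denominator: "\<exists>n p. lX ^ n * z = laurent p"
proof -
  have add: "\<exists>n p. lX ^ n * (x + y) = laurent p"
    if "\<exists>n p. lX ^ n * x = laurent p" "\<exists>n p. lX ^ n * y = laurent p" for x y :: "'a laurent_poly"
  proof -
    from that(1) obtain n p where "lX ^ n * x = laurent p" by blast
    moreover from that(2) obtain m q where "lX ^ m * y = laurent q" by blast
    ultimately show ?thesis using laurent_add_denominators by blast
  qed
  have sing: "\<exists>n p. lX ^ n * Poly_Mapping.single k c = laurent p" for k and c :: 'a
  proof -
    have "lX ^ nat \<bar>k\<bar> * Poly_Mapping.single k c = Poly_Mapping.single (\<bar>k\<bar> + k) c"
      by (simp add: lX_power mult_single)
    also have "Poly_Mapping.single (\<bar>k\<bar> + k) c = lconst c * lX ^ nat (\<bar>k\<bar> + k)"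
    proof -
      have "0 \<le> \<bar>k\<bar> + k" by linarith
      then show ?thesis by (simp add: lX_power mult_single)
    qed
    also have "\<dots> = laurent (smult c (monom 1 (nat (\<bar>k\<bar> + k))))" by (simp only: laurent_smult laurent_monom)
    finally show ?thesis by blast
  qed
  have "\<exists>n p. lX ^ n * (\<Sum>k\<in>A. Poly_Mapping.single k (Poly_Mapping.lookup z k)) = laurent p" for A
  proof (induction A rule: infinite_finite_induct)
    case (insert k A)
    then show ?case using add[OF sing] by simp
  qed (auto intro!: exI[of _ 0])
  then show ?thesis using laurent_sum_single[of z] by metis
qed

lemma laurent_clear_denominators: "\<exists>n ps. map ((*) (lX ^ n)) zs = map laurent ps"
proof (induction zs)
  case Nil then show ?case by simp
next
  case (Cons z zs)
  then obtain n ps where n: "map ((*) (lX ^ n)) zs = map laurent ps" by blast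
  obtain m p where m: "lX ^ m * z = laurent p" using laurent_clear_denominator by blast
  have "map ((*) (lX ^ (n + m))) zs = map ((*) (lX ^ m)) (map ((*) (lX ^ n)) zs)"
    by (simp add: power_add mult.assoc mult.left_commute)
  also have "\<dots> = map laurent (map ((*) (monom 1 m)) ps)"
    unfolding n by (simp add: laurent_mult laurent_monom)
  finally have "map ((*) (lX ^ (n + m))) (z # zs) = map laurent (monom 1 n * p # map ((*) (monom 1 m)) ps)"
    using m by (simp add: laurent_mult laurent_monom power_add mult.assoc)
  then show ?case by blast
qed

lemma idl_laurent:
  assumes "z \<in> idl (laurent ` F)"
  shows "\<exists>n. \<exists>p\<in>idl F. lX ^ n * z = laurent p"
  using assms
proof induction
  case zero
  then show ?case by (auto intro!: bexI[of _ 0] intro: idl.zero)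
next
  case (base a)
  then obtain p where "p \<in> F" "a = laurent p" by blast
  then show ?case by (auto intro!: exI[of _ 0] bexI[of _ p] intro: idl.base)
next
  case (add x y)
  then obtain n m p q where *: "p \<in> idl F" "q \<in> idl F" "lX ^ n * x = laurent p" "lX ^ m * y = laurent q" by blast
  from laurent_add_denominators[OF *(3,4)]
  have "lX ^ (n + m) * (x + y) = laurent (monom 1 m * p + monom 1 n * q)" .
  moreover have "monom 1 m * p + monom 1 n * q \<in> idl F" by (rule idl.add; rule idl.mult; fact)
  ultimately show ?case by blast
next
  case (mult a r)
  then obtain n p where *: "p \<in> idl F" "lX ^ n * a = laurent p" by blast
  obtain m q where q: "lX ^ m * r = laurent q" using laurent_clear_denominator by blast
  have "lX ^ (m + n) * (r * a) = (lX ^ m * r) * (lX ^ n * a)" by (simp add: power_add algebra_simps)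
  then have "lX ^ (m + n) * (r * a) = laurent (q * p)" by (simp only: * q laurent_mult)
  moreover have "q * p \<in> idl F" by (rule idl.mult) fact
  ultimately show ?case by blast
qed

lemma laurent_unimodular:
  assumes "1 \<in> idl (laurent ` F)"
  obtains n where "monom 1 n \<in> idl F"
proof -
  obtain n p where p: "p \<in> idl F" "lX ^ n * 1 = laurent p" using idl_laurent[OF assms] by blast
  then have "p = monom 1 n" by (intro laurent_inject) (simp add: laurent_monom)
  then show thesis using p that by blast
qed

lemma monom_in_bimonic: "monom 1 n \<in> bimonic"
  by (auto simp: bimonic_def degree_monom_eq intro!: exI[of _ n])

text \<open>
  This combines the two reductions. The bimonic polynomial \<open>s\<close> is divided by the power of \<open>X\<close> that
  it contains, giving \<open>s0\<close> with constant coefficient \<open>1\<close>, and \<open>G\<close> is the resulting first entry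
  \<open>g + (X\<^sup>-\<^sup>M + X\<^sup>M) s0\<close>, multiplied by \<open>X\<^sup>M\<close>. The choice of \<open>M\<close> keeps the terms of \<open>X\<^sup>M g\<close> strictly
  between the lowest and the highest term.
\<close>

lemma laurent_poly_row_equiv_e1:
  fixes g :: "'a :: comm_ring_1 poly"
  assumes dim: "dim_below {1} ({} :: 'a set) k" and k: "1 \<le> k" "k \<le> length fs"
    and uni: "1 \<in> idl (set (map laurent (g # fs)))"
  shows "map laurent (g # fs) \<sim>\<^sub>E e1 (length fs)"
proof (cases "2 \<le> length fs")
  case False
  then have "length fs = 1" using k by linarith
  then obtain f where f: "fs = [f]" by (auto simp: length_Suc_conv)
  have dim1: "dim_below {1} ({} :: 'a set) 1" using dim k f by (simp add: le_antisym)
  have "\<exists>a b. [g, f] \<sim>\<^sub>E [a, b] \<and> (\<forall>P. prime_set P \<longrightarrow> 1 \<notin> P \<longrightarrow> b \<in> extension P)"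
    using prime_set_zero
    by (intro zero_dim_euclid[OF dim1, of _ "Suc (degree g)" _ "Suc (degree f)"]) (auto simp: coeff_eq_0 Suc_le_eq)
  then obtain a b where eq: "[g, f] \<sim>\<^sub>E [a, b]" and b: "\<And>P. prime_set P \<Longrightarrow> b \<in> extension P"
    using prime_set_one by blast
  have eq': "map laurent (g # fs) \<sim>\<^sub>E [laurent a, laurent b]"
    using row_equiv_laurent[OF eq] f by simp
  have "1 \<in> idl {laurent a}"
  proof (rule one_in_idlI)
    fix Q :: "'a laurent_poly set" assume Q: "prime_set Q" "{laurent a} \<subseteq> Q"
    have PQ: "prime_set {p. laurent p \<in> Q}"
      by (rule prime_set_vimage[where h = laurent, OF Q(1) laurent_add laurent_mult]) simp_all
    have "b \<in> {p. laurent p \<in> Q}"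
      using b[OF prime_set_contraction[OF PQ]] by (intro poly_in_prime[OF PQ]) (simp add: extension_def)
    then have "set [laurent a, laurent b] \<subseteq> Q" using Q by simp
    then have "idl (set (map laurent (g # fs))) \<subseteq> Q"
      unfolding row_equiv_idl[OF eq', symmetric] by (rule prime_set_idl[OF Q(1)])
    then show False using uni prime_set_one[OF Q(1)] by blast
  qed
  then obtain r where r: "1 = r * laurent a" by (rule idl_singletonE)
  have "[laurent a, laurent b] \<sim>\<^sub>E e1 (length [laurent b])"
    by (rule row_equiv_unit[of _ r]) (use r in \<open>simp_all add: mult.commute\<close>)
  then show ?thesis using row_equiv_trans'[OF eq'] f by simp
next
  case True
  \<comment> \<open>Powers of \<open>X\<close> are bimonic, so unimodularity over Laurent polynomials is all that is required.\<close>
  obtain N where N: "monom 1 N \<in> idl (set (g # fs))"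
    using laurent_unimodular[of "set (g # fs)"] uni by auto
  obtain ts where ts: "length ts = length fs" and
    tsP: "\<And>P. prime_set P \<Longrightarrow> P \<inter> bimonic = {} \<Longrightarrow>
       set (map2 (\<lambda>f t. f + t * g) fs ts) \<subseteq> P \<Longrightarrow> g \<in> P"
    using bimonic_stable_range[OF dim k(2), of g] by auto
  define fs' where "fs' = map2 (\<lambda>f t. f + t * g) fs ts"
  have eq1: "g # fs \<sim>\<^sub>E g # fs'" unfolding fs'_def by (rule row_equiv_add_tail[OF ts])
  have "idl (set fs') \<inter> bimonic \<noteq> {}"
  proof
    assume "idl (set fs') \<inter> bimonic = {}"
    then obtain P where P: "prime_set P" "set fs' \<subseteq> P" "P \<inter> bimonic = {}"
      by (rule prime_set_exists[OF mult_closed_bimonic])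
    then have "set (g # fs') \<subseteq> P" using tsP[of P] unfolding fs'_def by auto
    then have "idl (set (g # fs)) \<subseteq> P"
      unfolding row_equiv_idl[OF eq1, symmetric] by (rule prime_set_idl[OF P(1)])
    then show False using N monom_in_bimonic[of N] P(3) by blast
  qed
  then obtain s where s: "s \<in> idl (set fs')" "s \<in> bimonic" by blast
  then obtain i where i: "lead_coeff s = 1" "coeff s i = 1" "\<forall>j<i. coeff s j = 0" by (auto simp: bimonic_def)
  define s0 where "s0 = poly_shift i s"
  have s0: "s = monom 1 i * s0"
    using i(3) by (intro poly_eqI) (simp add: s0_def coeff_monom_mult coeff_poly_shift)
  have ds: "degree s = i + degree s0" and ls0: "lead_coeff s0 = 1"
  proof -
    have "i \<le> degree s" using i(2) by (intro le_degree) simp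
    moreover have "degree s0 = degree s - i"
    proof (rule antisym)
      show "degree s0 \<le> degree s - i" by (rule degree_le) (auto simp: s0_def coeff_poly_shift coeff_eq_0)
      show "degree s - i \<le> degree s0" using i(1) \<open>i \<le> degree s\<close> by (intro le_degree) (simp add: s0_def coeff_poly_shift)
    qed
    ultimately show "degree s = i + degree s0" "lead_coeff s0 = 1" using i(1) by (simp_all add: s0_def coeff_poly_shift)
  qed
  have cs0: "coeff s0 0 = 1" using i(2) by (simp add: s0_def coeff_poly_shift)
  define M where "M = Suc (degree g + degree s0)"
  define G where "G = monom 1 M * g + (1 + monom 1 (2 * M)) * s0"
  define F where "F = map ((*) (monom 1 M)) fs'"
  have cG: "coeff G j = (if j < M then 0 else coeff g (j - M)) + coeff s0 j + (if j < 2 * M then 0 else coeff s0 (j - 2 * M))" for j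
    by (simp add: G_def distrib_right coeff_monom_mult)
  have G0: "coeff G 0 = 1" using cs0 by (simp add: cG M_def)
  have top: "coeff G (2 * M + degree s0) = 1" using ls0 by (simp add: cG M_def coeff_eq_0)
  have "degree G = 2 * M + degree s0"
  proof (rule antisym)
    show "degree G \<le> 2 * M + degree s0" by (rule degree_le) (auto simp: cG M_def coeff_eq_0)
    show "2 * M + degree s0 \<le> degree G" by (rule le_degree) (simp add: top)
  qed
  then have lG: "lead_coeff G = 1" using top by simp
  define c where "c = (lXinv ^ M + lX ^ M) * laurent s0"
  have "laurent s = lX ^ i * laurent s0" by (simp add: s0 laurent_mult laurent_monom)
  then have "lXinv ^ i * laurent s = (lX ^ i * lXinv ^ i) * laurent s0" by (simp only: ac_simps)
  then have "laurent s0 = lXinv ^ i * laurent s" by (simp only: lX_power_inverse mult_1_left)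
  moreover have "laurent s \<in> idl (set (map laurent fs'))"
    using s(1)
  proof induction
    case (mult a r) then show ?case by (simp add: laurent_mult idl.mult)
  qed (auto simp: laurent_add intro: idl.intros)
  ultimately have "laurent s0 \<in> idl (set (map laurent fs'))"
    using idl.mult[of "laurent s" "set (map laurent fs')" "lXinv ^ i"] by (simp only:)
  then have "c \<in> idl (set (map laurent fs'))" unfolding c_def by (rule idl.mult)
  then have eq2: "laurent g # map laurent fs' \<sim>\<^sub>E (laurent g + c) # map laurent fs'" by (rule row_equiv_add_head)
  have eq12: "map laurent (g # fs) \<sim>\<^sub>E (laurent g + c) # map laurent fs'"
    using row_equiv_laurent[OF eq1] eq2 row_equiv_trans' by fastforce
  have "lX ^ M * c = laurent ((1 + monom 1 (2 * M)) * s0)"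
  proof -
    have "lX ^ M * c = (lX ^ M * lXinv ^ M + lX ^ M * lX ^ M) * laurent s0"
      by (simp only: c_def distrib_left mult.assoc[symmetric])
    also have "\<dots> = laurent ((1 + monom 1 (2 * M)) * s0)"
      by (simp add: lX_power_inverse laurent_mult laurent_add laurent_monom mult_2 power_add)
    finally show ?thesis .
  qed
  then have scaled: "map ((*) (lX ^ M)) ((laurent g + c) # map laurent fs') = map laurent (G # F)"
    by (simp add: G_def F_def laurent_add laurent_mult laurent_monom distrib_left)
  have "1 \<in> idl (set ((laurent g + c) # map laurent fs'))" using row_equiv_idl[OF eq12] uni by simp
  from idl_unit_scale[OF lX_power_inverse[of M] this] have "1 \<in> idl (laurent ` set (G # F))"
    using arg_cong[OF scaled, of set] by (metis set_map)
  then obtain N' where N': "monom 1 N' \<in> idl (set (G # F))" by (rule laurent_unimodular)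
  have uniG: "1 \<in> idl (set (G # F))"
  proof (rule one_in_idlI)
    fix P assume P: "prime_set P" "set (G # F) \<subseteq> P"
    have "monom 1 N' = monom 1 (Suc 0) ^ N'" by (simp add: monom_power)
    then have x: "monom 1 (Suc 0) \<in> P" using prime_set_idlD[OF P(1) N' P(2)] prime_set_power[OF P(1)] by metis
    obtain a G' where G': "G = pCons a G'" by (cases G)
    then have "G = 1 + G' * monom 1 (Suc 0)" using G0
      by (simp add: monom_Suc monom_0 one_pCons)
    then have "1 = G - G' * monom 1 (Suc 0)" by simp
    also have "\<dots> \<in> P" using P x by (intro prime_set_diff[OF P(1)] prime_set_mult[OF P(1)]) auto
    finally show False using prime_set_one[OF P(1)] by simp
  qed
  have lF: "length F = length fs" using ts by (simp add: F_def fs'_def)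
  have "G # F \<sim>\<^sub>E e1 (length F)"
    by (rule monic_row_equiv_e1[OF dim lG uniG]) (use lF k True in auto)
  from row_equiv_laurent[OF this] have
    eqM: "map ((*) (lX ^ M)) ((laurent g + c) # map laurent fs') \<sim>\<^sub>E e1 (length fs)"
    unfolding scaled lF by simp
  have "0 < length fs" using True by linarith
  from row_equiv_unit_scale[OF lX_power_inverse[of M] this eqM]
  have "(laurent g + c) # map laurent fs' \<sim>\<^sub>E e1 (length fs)" .
  then show ?thesis by (rule row_equiv_trans'[OF eq12])
qed

theorem laurent_row_equiv_e1:
  fixes x :: "'a :: comm_ring_1 laurent_poly"
  assumes dim: "dim_below {1} ({} :: 'a set) k" and k: "1 \<le> k" "k \<le> length xs"
    and uni: "1 \<in> idl (set (x # xs))"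
  shows "x # xs \<sim>\<^sub>E e1 (length xs)"
proof -
  obtain n ps where ps: "map ((*) (lX ^ n)) (x # xs) = map laurent ps" using laurent_clear_denominators by blast
  then obtain g fs where gfs: "ps = g # fs" by (cases ps) auto
  have l: "length fs = length xs" using arg_cong[OF ps, of length] gfs by simp
  have "1 \<in> idl (set (map laurent (g # fs)))"
    using idl_unit_scale[OF lX_power_inverse[of n] uni] unfolding gfs[symmetric] ps[symmetric] by simp
  then have "map laurent (g # fs) \<sim>\<^sub>E e1 (length fs)"
    using k l by (intro laurent_poly_row_equiv_e1[OF dim]) auto
  then have eqn: "map ((*) (lX ^ n)) (x # xs) \<sim>\<^sub>E e1 (length xs)" unfolding ps gfs l .
  have "0 < length xs" using k by linarith
  from row_equiv_unit_scale[OF lX_power_inverse[of n] this eqn] show ?thesis .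
qed

section \<open>Matrices and Krull dimension\<close>

lemma primeideal_if_prime_set:
  assumes P: "prime_set (P :: 'a :: comm_ring_1 set)"
  shows "primeideal P (ring_of_type_algebra :: 'a ring)"
proof (rule primeidealI)
  let ?R = "ring_of_type_algebra :: 'a ring"
  interpret cring ?R by (rule cring_from_type_algebra)
  note simps = ring_of_type_algebra_def
  have inv: "a \<in> P \<Longrightarrow> \<ominus>\<^bsub>?R\<^esub> a \<in> P" for a
  proof -
    assume a: "a \<in> P"
    have "\<ominus>\<^bsub>?R\<^esub> a = - a" by (rule minus_equality) (simp_all add: simps)
    then show "\<ominus>\<^bsub>?R\<^esub> a \<in> P" using prime_set_uminus[OF P a] by simp
  qed
  show "ideal P ?R"
  proof (rule idealI)
    show "ring ?R" by (rule ring_axioms)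
    show "subgroup P (add_monoid ?R)"
    proof (rule subgroup.intro)
      show "inv\<^bsub>add_monoid ?R\<^esub> a \<in> P" if "a \<in> P" for a
        using inv[OF that] by (simp add: a_inv_def)
    qed (auto simp: simps prime_set_add[OF P] prime_set_zero[OF P])
  qed (auto simp: simps prime_set_mult[OF P] prime_set_mult_right[OF P])
  show "cring ?R" by (rule is_cring)
  show "carrier ?R \<noteq> P" using prime_set_one[OF P] by (auto simp: simps)
qed (use prime_set_mult_iff[OF P] in \<open>auto simp: ring_of_type_algebra_def\<close>)

text \<open>
  A chain of \<open>n\<close> primes has length \<open>n - 1\<close>, which exceeds a Krull dimension of at most \<open>n - 2\<close>.
\<close>

lemma dim_below_if_krull_dim:
  assumes "krull_dim (ring_of_type_algebra :: 'a :: comm_ring_1 ring) + 2 \<le> enat n"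
  shows "dim_below {1} ({} :: 'a set) (n - 1)"
proof (rule ccontr)
  let ?R = "ring_of_type_algebra :: 'a ring"
  assume "\<not> ?thesis"
  then obtain P :: "nat \<Rightarrow> 'a set" where P: "\<And>i. i \<le> n - 1 \<Longrightarrow> prime_set (P i)" "\<And>i. i < n - 1 \<Longrightarrow> P i \<subset> P (Suc i)"
    by (rule not_dim_belowE) blast
  then have "\<exists>P :: nat \<Rightarrow> 'a set. (\<forall>i\<le>n - 1. primeideal (P i) ?R) \<and> (\<forall>i<n - 1. P i \<subset> P (Suc i))"
    using primeideal_if_prime_set by blast
  then have "enat (n - 1) \<le> krull_dim ?R" unfolding krull_dim_def by (intro Sup_upper) auto
  then have "enat (n - 1) + 2 \<le> enat n" using assms by (metis add_right_mono order_trans)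
  then show False by (simp add: numeral_eq_enat)
qed

lemma row_mult_transpose:
  assumes "x \<in> carrier_vec n" "M \<in> carrier_mat n n"
  shows "row_mult x M = transpose_mat M *\<^sub>v x"
proof (rule eq_vecI)
  have x: "vec n (($) x) = x" using assms by (intro eq_vecI) auto
  fix i assume "i < dim_vec (transpose_mat M *\<^sub>v x)"
  then have "i < n" using assms by simp
  then show "row_mult x M $ i = (transpose_mat M *\<^sub>v x) $ i"
    using assms x comm_scalar_prod[OF assms(1), of "col M i"] by (simp add: row_mult_def mat_of_row_def)
qed (use assms in \<open>simp add: row_mult_def mat_of_row_def\<close>)

lemma row_mult_carrier: "x \<in> carrier_vec n \<Longrightarrow> M \<in> carrier_mat n n \<Longrightarrow> row_mult x M \<in> carrier_vec n"
  by (simp add: row_mult_transpose)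

lemma row_mult_one: "x \<in> carrier_vec n \<Longrightarrow> row_mult x (1\<^sub>m n) = x"
  by (simp add: row_mult_transpose[of _ n])

lemma row_mult_mult:
  assumes "x \<in> carrier_vec n" "M \<in> carrier_mat n n" "N \<in> carrier_mat n n"
  shows "row_mult x (M * N) = row_mult (row_mult x M) N"
  using assms by (simp add: row_mult_transpose[of _ n] transpose_mult[of M n n N n] assoc_mult_mat_vec[of _ n n _ n])

lemma general_linear_simps:
  "\<one>\<^bsub>general_linear T n\<^esub> = 1\<^sub>m n" "x \<otimes>\<^bsub>general_linear T n\<^esub> y = x * y"
  by (simp_all add: general_linear_def units_of_one units_of_mult ring_mat_simps)

lemma general_linear_carrierD:
  "M \<in> carrier (general_linear TYPE('a :: comm_ring_1) n) \<Longrightarrow>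
   M \<in> carrier_mat n n \<and> (\<exists>N \<in> carrier_mat n n. M * N = (1\<^sub>m n :: 'a mat))"
  by (auto simp: general_linear_def units_of_carrier Units_def ring_mat_simps)

lemma group_general_linear: "group (general_linear TYPE('a :: comm_ring_1) n)"
  unfolding general_linear_def
  by (intro monoid.units_group ring.is_monoid ring_mat)

lemma elementary_group_carrier:
  "carrier (elementary_group TYPE('a :: comm_ring_1) n) \<subseteq> carrier (general_linear TYPE('a) n)"
  unfolding elementary_group_def by (rule group.carrier_subgroup_generated_subset[OF group_general_linear])

lemma unimodular_rowsD:
  assumes "x \<in> unimodular_rows n"
  shows "x \<in> carrier_vec n" "1 \<in> idl (set (list_of_vec x))"
proof -
  show x: "x \<in> carrier_vec n" using assms by (simp add: unimodular_rows_def)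
  obtain y where y: "y \<in> carrier_vec n" "x \<bullet> y = 1" using assms unfolding unimodular_rows_def by (smt (verit) UNIV_I mem_Collect_eq)
  have "x \<bullet> y = (\<Sum>i<n. x $ i * y $ i)" using y by (simp add: scalar_prod_def atLeast0LessThan)
  also have "\<dots> \<in> idl (set (list_of_vec x))"
    using x by (intro idl_sum idl_mult_right idl.base) (auto simp: in_set_conv_nth intro!: exI)
  finally show "1 \<in> idl (set (list_of_vec x))" using y by simp
qed

lemma row_mult_unimodular:
  assumes x: "x \<in> unimodular_rows n" and M: "M \<in> carrier (general_linear TYPE('a :: comm_ring_1) n)"
  shows "row_mult x M \<in> unimodular_rows n"
proof -
  obtain N where MN: "M \<in> carrier_mat n n" "N \<in> carrier_mat n n" "M * N = 1\<^sub>m n"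
    using general_linear_carrierD[OF M] by blast
  have xc: "x \<in> carrier_vec n" using x by (simp add: unimodular_rows_def)
  have "z \<in> {row_mult x M \<bullet> y | y. y \<in> carrier_vec n}" for z
  proof -
    obtain y where y: "y \<in> carrier_vec n" "x \<bullet> y = z" using x unfolding unimodular_rows_def by (smt (verit) UNIV_I mem_Collect_eq)
    have "row_mult x M \<bullet> (N *\<^sub>v y) = x \<bullet> (M *\<^sub>v (N *\<^sub>v y))"
      unfolding row_mult_transpose[OF xc MN(1)] using MN y xc by (intro transpose_vec_mult_scalar) auto
    also have "M *\<^sub>v (N *\<^sub>v y) = y" using MN y by (simp flip: assoc_mult_mat_vec)
    finally show ?thesis using y MN by (intro CollectI exI[of _ "N *\<^sub>v y"]) auto
  qed
  then show ?thesis unfolding unimodular_rows_def using row_mult_carrier[OF xc MN(1)] by blast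
qed

lemma row_mult_addrow:
  assumes x: "x \<in> carrier_vec n" and ij: "i < n" "j < n" "i \<noteq> j"
  shows "list_of_vec (row_mult x (addrow_mat n a i j)) = (list_of_vec x)[j := x $ j + a * x $ i]"
proof (rule nth_equalityI)
  have c: "row_mult x (addrow_mat n a i j) \<in> carrier_vec n" using x by (intro row_mult_carrier) auto
  then show "length (list_of_vec (row_mult x (addrow_mat n a i j))) = length ((list_of_vec x)[j := x $ j + a * x $ i])"
    using x by simp
  fix l assume "l < length (list_of_vec (row_mult x (addrow_mat n a i j)))"
  then have l: "l < n" using c by simp
  have "row_mult x (addrow_mat n a i j) $ l = (\<Sum>r<n. addrow_mat n a i j $$ (r, l) * x $ r)"
    using x l by (simp add: row_mult_transpose[OF x] scalar_prod_def atLeast0LessThan)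
  also have "\<dots> = (\<Sum>r<n. (if r = l then x $ l else 0) + (if r = i \<and> l = j then a * x $ i else 0))"
    using l ij by (intro sum.cong) (auto simp: addrow_mat_def algebra_simps)
  also have "\<dots> = x $ l + (if l = j then a * x $ i else 0)"
    using l ij by (auto simp: sum.distrib)
  finally show "list_of_vec (row_mult x (addrow_mat n a i j)) ! l = (list_of_vec x)[j := x $ j + a * x $ i] ! l"
    using l x c by (auto simp: list_of_vec_index nth_list_update)
qed

lemma row_equiv_row_mult:
  fixes xs :: "'a :: comm_ring_1 list"
  assumes "xs \<sim>\<^sub>E ys" "length xs = n"
  shows "\<exists>M\<in>carrier (elementary_group TYPE('a) n). row_mult (vec_of_list xs) M = vec_of_list ys"
  using assms
proof (induction rule: row_equiv.induct)
  case (refl xs)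
  let ?G = "general_linear TYPE('a) n"
  have "\<one>\<^bsub>?G\<^esub> \<in> carrier (elementary_group TYPE('a) n)"
    unfolding elementary_group_def
    using group.subgroup_subgroup_generated[OF group_general_linear] subgroup.one_closed by blast
  then show ?case using refl by (intro bexI[of _ "1\<^sub>m n"]) (auto simp: general_linear_simps row_mult_one carrier_dim_vec)
next
  case (step xs ys i j a)
  let ?E = "elementary_group TYPE('a) n"
  obtain M where M: "M \<in> carrier ?E" "row_mult (vec_of_list xs) M = vec_of_list ys" using step by blast
  have len: "length ys = n" using row_equiv_length step by metis
  let ?A = "addrow_mat n a i j"
  let ?G = "general_linear TYPE('a) n"
  have elem: "?A \<in> elementary_matrices n" using step.hyps len unfolding elementary_matrices_def by blast
  then have "?A \<in> carrier ?G" by (rule subsetD[OF elementary_matrices_subset_general_linear])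
  then have "?A \<in> generate ?G (carrier ?G \<inter> elementary_matrices n)" using elem by (intro generate.incl IntI)
  then have A: "?A \<in> carrier ?E" unfolding elementary_group_def carrier_subgroup_generated .
  interpret E: group ?E unfolding elementary_group_def by (rule group.group_subgroup_generated[OF group_general_linear])
  have MA: "M \<otimes>\<^bsub>?E\<^esub> ?A \<in> carrier ?E" using M A by blast
  have eq: "M \<otimes>\<^bsub>?E\<^esub> ?A = M * ?A" by (simp add: elementary_group_def general_linear_simps)
  have Mc: "M \<in> carrier_mat n n" using M elementary_group_carrier general_linear_carrierD by blast
  have "vec_of_list xs \<in> carrier_vec n" using step.prems by (simp add: carrier_dim_vec)
  then have "row_mult (vec_of_list xs) (M * ?A) = row_mult (vec_of_list ys) ?A"
    using Mc M by (simp add: row_mult_mult[of _ n])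
  moreover have "vec_of_list ys \<in> carrier_vec n" using len by (simp add: carrier_dim_vec)
  then have "list_of_vec (row_mult (vec_of_list ys) ?A) = ys[j := ys ! j + a * ys ! i]"
    using step len by (subst row_mult_addrow) (auto simp: list_vec vec_of_list_index)
  then have "row_mult (vec_of_list ys) ?A = vec_of_list (ys[j := ys ! j + a * ys ! i])" by (metis vec_list)
  ultimately show ?case using MA unfolding eq by metis
qed

theorem theorem1p3:
  fixes n :: nat
  assumes "krull_dim (ring_of_type_algebra :: 'a :: comm_ring_1 ring) < \<infinity>"
    and "enat n \<ge> krull_dim (ring_of_type_algebra :: 'a :: comm_ring_1 ring) + 2"
  shows "transitive_right_action
           (elementary_group TYPE('a laurent_poly) n)
           (unimodular_rows n :: 'a laurent_poly vec set)
           row_mult"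
proof -
  let ?E = "elementary_group TYPE('a laurent_poly) n"
  have "enat 2 \<le> enat n" using assms(2) by (metis add_increasing le_zero_eq numeral_eq_enat order_trans zero_le linorder_le_cases)
  then have n2: "2 \<le> n" by simp
  have dim: "dim_below {1} ({} :: 'a set) (n - 1)" by (rule dim_below_if_krull_dim) (rule assms(2))
  have carrier_E: "M \<in> carrier_mat n n" "M \<in> carrier (general_linear TYPE('a laurent_poly) n)" if "M \<in> carrier ?E" for M
    using that elementary_group_carrier general_linear_carrierD by blast+
  have to_e1: "list_of_vec x \<sim>\<^sub>E e1 (n - 1)" if "x \<in> unimodular_rows n" for x :: "'a laurent_poly vec"
  proof -
    note x = unimodular_rowsD[OF that]
    have len: "length (list_of_vec x) = n" using x(1) by simp
    then obtain a as where as: "list_of_vec x = a # as" using n2 by (cases "list_of_vec x") auto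
    then have l: "length as = n - 1" using len by simp
    have "a # as \<sim>\<^sub>E e1 (length as)"
      by (rule laurent_row_equiv_e1[OF dim]) (use x(2) n2 as l in auto)
    then show ?thesis unfolding as l .
  qed
  have trans: "\<exists>g\<in>carrier ?E. row_mult x g = y"
    if x: "x \<in> unimodular_rows n" and y: "y \<in> unimodular_rows n" for x y :: "'a laurent_poly vec"
  proof -
    have "list_of_vec x \<sim>\<^sub>E list_of_vec y"
      using row_equiv_trans'[OF to_e1[OF x] row_equiv_sym[OF to_e1[OF y]]] .
    from row_equiv_row_mult[OF this, of n] show ?thesis
      using unimodular_rowsD(1)[OF x] by (simp add: vec_list)
  qed
  have "right_action ?E (unimodular_rows n :: 'a laurent_poly vec set) row_mult"
    unfolding right_action_def
  proof (intro conjI ballI)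
    show "group ?E" unfolding elementary_group_def by (rule group.group_subgroup_generated[OF group_general_linear])
    fix x :: "'a laurent_poly vec" assume x: "x \<in> unimodular_rows n"
    note xc = unimodular_rowsD(1)[OF x]
    show "row_mult x \<one>\<^bsub>?E\<^esub> = x"
      using row_mult_one[OF xc] by (simp add: elementary_group_def general_linear_simps)
    fix g assume g: "g \<in> carrier ?E"
    show "row_mult x g \<in> unimodular_rows n" by (rule row_mult_unimodular[OF x carrier_E(2)[OF g]])
    fix h assume h: "h \<in> carrier ?E"
    show "row_mult x (g \<otimes>\<^bsub>?E\<^esub> h) = row_mult (row_mult x g) h"
      using row_mult_mult[OF xc carrier_E(1)[OF g] carrier_E(1)[OF h]]
      by (simp add: elementary_group_def general_linear_simps)
  qed
  then show ?thesis unfolding transitive_right_action_def using trans by blast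
qed

end
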